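(* Let $\mathcal{A}=(l_1,l_2,\dots,l_m)$ be a monomial curve in $\mathbb{A}^m$ with Markov complexity $m(\mathcal{A})=2$. Then for any distinct $i,j,k\in\{1,2,\dots,m\}$, the monomial curve $\mathcal{B}=(l_i,l_j,l_k)$ in $\mathbb{A}^3$ is a complete intersection.
   Context: A monomial curve in $\mathbb{A}^n$ is given by $n$ distinct positive integers $\mathcal{A}=(a_1,\dots,a_n)$, regarded as a $1\times n$ integer matrix $A$. Its toric ideal $I_{\mathcal{A}}\subset \Bbbk[x_1,\dots,x_n]$ ($\Bbbk$ a field) is generated by all binomials $x^{u}-x^{w}$ with $u,w\in\mathbb{N}^n$ and $u-w\in\ker_{\mathbb{Z}}(A)$; it has height $n-1$. The monomial curve is a complete intersection if $I_{\mathcal{A}}$ can be generated by $n-1$ elements. For an integer matrix $M$ with $N$ columns and nonnegative entries such that $\ker_{\mathbb{Z}}(M)\cap\mathbb{N}^N=\{0\}$ (here $0\in\mathbb{N}$), a Markov basis of $M$ is a finite subset $\mathcal{M}\subset\ker_{\mathbb{Z}}(M)$ such that for all $w,u\in\mathbb{N}^N$ with $w-u\in\ker_{\mathbb{Z}}(M)$ there is a finite sequence $v_1,\dots,v_s$ of elements which up to sign belong to $\mathcal{M}$ (repetitions allowed), with $w-u=\sum_{i=1}^s v_i$ and $w-\sum_{i=1}^p v_i\in\mathbb{N}^N$ for all $1\le p\le s$. A Markov basis is minimal if no proper subset of it is a Markov basis. The universal Markov basis of $M$ is the union of all minimal Markov bases of $M$, where elements differing by a sign are identified. For $r\ge 2$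 the $r$-th Lawrence lifting $A^{(r)}$ of a $k\times n$ matrix $A$ is the $(rk+n)\times rn$ matrix whose first $rk$ rows form the block diagonal matrix with $r$ diagonal blocks equal to $A$, and whose last $n$ rows are $(I_n\ I_n\ \cdots\ I_n)$. An element of $\ker_{\mathbb{Z}}(A^{(r)})$ is identified with an $r\times n$ integer matrix each of whose rows lies in $\ker_{\mathbb{Z}}(A)$ and whose rows sum to zero. The type of such an element is the number of its nonzero rows. The Markov complexity $m(\mathcal{A})$ is the largest type of any element of the universal Markov basis of $A^{(r)}$, as $r\ge2$ varies. (The integer $m$ and the function $m(\cdot)$ are unrelated.) *)

theory Defs
  imports
    "HOL-Library.Extended_Nat"
    "HOL-Library.Poly_Mapping"
    "HOL-Algebra.Ideal"
    "Jordan_Normal_Form.Matrix_Kernel"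
begin

section \<open>Markov bases of an integer matrix\<close>

text \<open>Elements of \<open>\<nat>\<^sup>N\<close> are represented as the nonnegative integer vectors of length \<open>N\<close>.\<close>

definition nonneg_vecs :: "nat \<Rightarrow> int vec set" where
  "nonneg_vecs N = {v \<in> carrier_vec N. \<forall>i<N. 0 \<le> v $ i}"

definition vec_sum :: "nat \<Rightarrow> int vec list \<Rightarrow> int vec" where
  "vec_sum N vs = foldr (+) vs (0\<^sub>v N)"

text \<open>This notion is only meant for matrices \<open>M\<close> with nonnegative entries whose integer kernel
  meets \<open>\<nat>\<^sup>N\<close> only in zero; the matrices of monomial curves and their Lawrence liftings
  are of this kind.\<close>

definition is_markov_basis :: "int mat \<Rightarrow> int vec set \<Rightarrow> bool" where
  "is_markov_basis M B \<longleftrightarrow>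
     finite B \<and> B \<subseteq> mat_kernel M \<and>
     (\<forall>w \<in> nonneg_vecs (dim_col M). \<forall>u \<in> nonneg_vecs (dim_col M).
        w - u \<in> mat_kernel M \<longrightarrow>
        (\<exists>vs. set vs \<subseteq> B \<union> uminus ` B \<and>
              w - u = vec_sum (dim_col M) vs \<and>
              (\<forall>p \<in> {1..length vs}.
                 w - vec_sum (dim_col M) (take p vs) \<in> nonneg_vecs (dim_col M))))"

definition is_minimal_markov_basis :: "int mat \<Rightarrow> int vec set \<Rightarrow> bool" where
  "is_minimal_markov_basis M B \<longleftrightarrow>
     is_markov_basis M B \<and> (\<forall>B'. B' \<subset> B \<longrightarrow> \<not> is_markov_basis M B')"

text \<open>Elements differing by a sign are usually identified here. We take the plain union, that is,
  both representatives \<open>v\<close> and \<open>- v\<close> of each class: the type defined below does not depend on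
  the sign.\<close>

definition universal_markov_basis :: "int mat \<Rightarrow> int vec set" where
  "universal_markov_basis M = \<Union> {B. is_minimal_markov_basis M B}"


section \<open>Lawrence liftings and Markov complexity\<close>

definition lawrence_lifting :: "nat \<Rightarrow> int mat \<Rightarrow> int mat" where
  "lawrence_lifting r A =
     diag_block_mat (replicate r A) @\<^sub>r
     mat (dim_col A) (r * dim_col A) (\<lambda>(i, j). if j mod dim_col A = i then 1 else 0)"

text \<open>A vector of length \<open>r * n\<close> is read as the \<open>r \<times> n\<close> matrix whose entry at \<open>(i, j)\<close>
  is the coordinate with index \<open>i * n + j\<close>.\<close>

definition lawrence_type :: "nat \<Rightarrow> nat \<Rightarrow> int vec \<Rightarrow> nat" where
  "lawrence_type r n v = card {i. i < r \<and> (\<exists>j<n. v $ (i * n + j) \<noteq> 0)}"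

text \<open>The supremum is taken in \<^typ>\<open>enat\<close>: it is the largest type if the types are bounded, and
  \<open>\<infinity>\<close> otherwise (and \<open>0\<close> if all universal Markov bases are empty).\<close>

definition markov_complexity :: "int mat \<Rightarrow> enat" where
  "markov_complexity A =
     (SUP r \<in> {2..}. SUP v \<in> universal_markov_basis (lawrence_lifting r A).
        enat (lawrence_type r (dim_col A) v))"


section \<open>Toric ideals and complete intersections\<close>

text \<open>Polynomials in the variables \<open>x\<^sub>0, x\<^sub>1, \<dots>\<close> are the elements of
  \<^typ>\<open>(nat \<Rightarrow>\<^sub>0 nat) \<Rightarrow>\<^sub>0 'k\<close>, an outer index being the exponent vector of a monomial.
  The ring of polynomials in \<open>x\<^sub>0, \<dots>, x\<^sub>n\<^sub>-\<^sub>1\<close> is cut out by restricting the exponents.\<close>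

definition exponents :: "nat \<Rightarrow> (nat \<Rightarrow>\<^sub>0 nat) set" where
  "exponents n = {u. Poly_Mapping.keys u \<subseteq> {..<n}}"

definition poly_ring :: "nat \<Rightarrow> ((nat \<Rightarrow>\<^sub>0 nat) \<Rightarrow>\<^sub>0 'k::field) ring" where
  "poly_ring n = \<lparr>carrier = {p. Poly_Mapping.keys p \<subseteq> exponents n},
                  mult = (*), one = 1, zero = 0, add = (+)\<rparr>"

lemma cring_poly_ring: "cring (poly_ring n :: ((nat \<Rightarrow>\<^sub>0 nat) \<Rightarrow>\<^sub>0 'k::field) ring)"
proof (rule cringI)
  have add: "Poly_Mapping.keys (p + q) \<subseteq> exponents n"
    if "Poly_Mapping.keys p \<subseteq> exponents n" "Poly_Mapping.keys q \<subseteq> exponents n" for p q :: "(nat \<Rightarrow>\<^sub>0 nat) \<Rightarrow>\<^sub>0 'k"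
    using that Poly_Mapping.keys_add[of p q] by blast
  have uminus: "Poly_Mapping.keys (- p) \<subseteq> exponents n"
    if "Poly_Mapping.keys p \<subseteq> exponents n" for p :: "(nat \<Rightarrow>\<^sub>0 nat) \<Rightarrow>\<^sub>0 'k"
    using that by (simp add: Poly_Mapping.keys.rep_eq uminus_poly_mapping.rep_eq)
  have exp_add: "a + b \<in> exponents n" if "a \<in> exponents n" "b \<in> exponents n" for a b
    using that Poly_Mapping.keys_add[of a b] by (auto simp: exponents_def)
  have mult: "Poly_Mapping.keys (p * q) \<subseteq> exponents n"
    if "Poly_Mapping.keys p \<subseteq> exponents n" "Poly_Mapping.keys q \<subseteq> exponents n" for p q :: "(nat \<Rightarrow>\<^sub>0 nat) \<Rightarrow>\<^sub>0 'k"
    using that Poly_Mapping.keys_mult[of p q] exp_add by blast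
  show "abelian_group (poly_ring n :: ((nat \<Rightarrow>\<^sub>0 nat) \<Rightarrow>\<^sub>0 'k) ring)"
  proof (rule abelian_groupI)
    fix x assume "x \<in> carrier (poly_ring n :: ((nat \<Rightarrow>\<^sub>0 nat) \<Rightarrow>\<^sub>0 'k) ring)"
    then show "\<exists>y \<in> carrier (poly_ring n). y \<oplus>\<^bsub>poly_ring n\<^esub> x = \<zero>\<^bsub>poly_ring n\<^esub>"
      by (intro bexI[of _ "- x"]) (auto simp: poly_ring_def uminus)
  qed (use add in \<open>auto simp: poly_ring_def ac_simps\<close>)
  show "comm_monoid (poly_ring n :: ((nat \<Rightarrow>\<^sub>0 nat) \<Rightarrow>\<^sub>0 'k) ring)"
    by (rule comm_monoidI) (use mult in \<open>auto simp: poly_ring_def exponents_def ac_simps\<close>)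
qed (auto simp: poly_ring_def algebra_simps)

definition monom_of :: "(nat \<Rightarrow>\<^sub>0 nat) \<Rightarrow> (nat \<Rightarrow>\<^sub>0 nat) \<Rightarrow>\<^sub>0 'k::field" where
  "monom_of u = Poly_Mapping.single u 1"

definition exponent_diff :: "nat \<Rightarrow> (nat \<Rightarrow>\<^sub>0 nat) \<Rightarrow> (nat \<Rightarrow>\<^sub>0 nat) \<Rightarrow> int vec" where
  "exponent_diff n u w = vec n (\<lambda>i. int (Poly_Mapping.lookup u i) - int (Poly_Mapping.lookup w i))"

definition toric_ideal :: "int mat \<Rightarrow> ((nat \<Rightarrow>\<^sub>0 nat) \<Rightarrow>\<^sub>0 'k::field) set" where
  "toric_ideal A =
     Idl\<^bsub>poly_ring (dim_col A)\<^esub>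
       {monom_of u - monom_of w | u w.
          u \<in> exponents (dim_col A) \<and> w \<in> exponents (dim_col A) \<and>
          exponent_diff (dim_col A) u w \<in> mat_kernel A}"

definition monomial_curve :: "nat list \<Rightarrow> bool" where
  "monomial_curve a \<longleftrightarrow> distinct a \<and> (\<forall>x \<in> set a. 0 < x)"

definition curve_matrix :: "nat list \<Rightarrow> int mat" where
  "curve_matrix a = mat 1 (length a) (\<lambda>(_, j). int (a ! j))"

definition complete_intersection :: "'k::field itself \<Rightarrow> nat list \<Rightarrow> bool" where
  "complete_intersection _ a \<longleftrightarrow>
     (\<exists>G \<subseteq> carrier (poly_ring (length a) :: ((nat \<Rightarrow>\<^sub>0 nat) \<Rightarrow>\<^sub>0 'k) ring).
        finite G \<and> card G = length a - 1 \<and>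
        toric_ideal (curve_matrix a) = Idl\<^bsub>poly_ring (length a)\<^esub> G)"

end

theory Submission
  imports Defs
begin

text \<open>For three weights $a, b, c$ let $n_1$ be the least positive integer such that $n_1 a$ lies in the
numerical semigroup generated by $b$ and $c$, and define $n_2$, $n_3$ symmetrically. Two cases are
possible.

If two of the numbers $n_1 a$, $n_2 b$, $n_3 c$ coincide, say $n_1 a = n_2 b$, then the toric ideal
is generated by $x^{n_1} - y^{n_2}$ and $z^{n_3} - x^s y^t$, where $n_3 c = s a + t b$: rewriting with
these two binomials brings every monomial into a form with $x$-exponent below $n_1$ and
$z$-exponent below $n_3$, and minimality of the three multiples makes this form unique in each
degree (\<open>coincident_reduced_unique\<close>, \<open>complete_intersection_if_coincident\<close>).

If all three are distinct, Herzog's analysis applies: the representations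
$n_1 a = u_{12} b + u_{13} c$, $n_2 b = u_{21} a + u_{23} c$, $n_3 c = u_{31} a + u_{32} b$ are
unique, all coefficients are positive, and the columns of the matrix $u$ (with zero diagonal) sum to
$n_1$, $n_2$, $n_3$. Hence $\mathrm{diag}(n_1, n_2, n_3) - u$ is an element of type 3 in the
kernel of the third Lawrence lifting. The fibre of $\mathrm{diag}(n_1, n_2, n_3)$ consists of this
matrix and $u$ only (\<open>noncoincident_fiber\<close>), and padding with zero columns changes nothing, because
nonnegative entries in a column with sum zero vanish. A path between the two points of such a
fibre must jump from one to the other in one step, so up to sign the element belongs to every
Markov basis (\<open>indispensable\<close>). Minimal Markov bases exist: the Graver basis is finite by Dickson's
lemma and is a Markov basis (\<open>graver_is_markov_basis\<close>). Hence the Markov complexity is at least 3, so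
complexity 2 forces the first case for every triple of weights.\<close>

section \<open>Critical multiples of a weight\<close>

definition critical :: "nat \<Rightarrow> nat \<Rightarrow> nat \<Rightarrow> nat \<Rightarrow> bool" where
  "critical n a b c \<longleftrightarrow>
     0 < n \<and> (\<exists>x y. n * a = x * b + y * c) \<and> (\<forall>m x y. 0 < m \<longrightarrow> m * a = x * b + y * c \<longrightarrow> n \<le> m)"

lemma critical_le: "critical n a b c \<Longrightarrow> 0 < m \<Longrightarrow> m * a = x * b + y * c \<Longrightarrow> n \<le> m"
  unfolding critical_def by blast

lemma critical_swap: "critical n a b c \<longleftrightarrow> critical n a c b"
  unfolding critical_def by (metis add.commute)

lemma critical_exists:
  assumes "0 < b" shows "\<exists>n. critical n a b c"
proof -
  let ?P = "\<lambda>n. 0 < n \<and> (\<exists>x y. n * a = x * b + y * c)"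
  have "b * a = a * b + 0 * c" by simp
  with assms have "?P b" by blast
  then have "?P (LEAST n. ?P n)" by (rule LeastI)
  moreover have "(LEAST n. ?P n) \<le> m" if "?P m" for m using that by (rule Least_le)
  ultimately show ?thesis unfolding critical_def by blast
qed

text \<open>Cancelling a common summand $s a$ would give a smaller multiple of $a$ in the semigroup of $b$ and
$c$. This is the form in which minimality is mostly applied.\<close>

lemma critical_cancel:
  assumes crit: "critical n a b c" and "0 < a" and eq: "n * a = s * a + x * b + y * c"
  shows "s = 0 \<or> s = n"
proof (rule ccontr)
  assume s: "\<not> (s = 0 \<or> s = n)"
  have "s * a \<le> n * a" using eq by simp
  with \<open>0 < a\<close> s have "s < n" by simp
  moreover have "(n - s) * a = x * b + y * c" using eq by (simp add: diff_mult_distrib)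
  ultimately have "n \<le> n - s" using crit critical_le by simp
  with s \<open>s < n\<close> show False by simp
qed

text \<open>If $q = n_2$ the first equation holds. If $q > n_2$, substitute the representation of $n_2 b$ into
$q b$: minimality of $n_1$ removes its $a$-part, so $n_2 b = t c$ for some $t$. If $t > n_3$, substituting
the representation of $n_3 c$ leads in the same way to $n_3 c = 0$; hence $t = n_3$.\<close>

lemma critical_pair:
  assumes pos: "0 < a" "0 < b" "0 < c"
    and crit: "critical n1 a b c" "critical n2 b a c" "critical n3 c a b"
    and eq: "n1 * a = q * b"
  shows "n1 * a = n2 * b \<or> n2 * b = n3 * c"
proof (rule ccontr)
  assume no: "\<not> ?thesis"
  have n: "0 < n1" "0 < n2" "0 < n3" using crit by (auto simp: critical_def)
  have "0 < q * b" using eq n pos by (metis nat_0_less_mult_iff)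
  then have "0 < q" by simp
  have "n2 \<le> q" using critical_le[OF crit(2) \<open>0 < q\<close>, of n1 0] eq by simp
  moreover have "n2 \<noteq> q" using no eq by blast
  ultimately have q: "0 < q - n2" "q * b = n2 * b + (q - n2) * b"
    by (auto simp: diff_mult_distrib)
  obtain s t where st: "n2 * b = s * a + t * c" using crit(2) by (auto simp: critical_def)
  have e1: "n1 * a = s * a + (q - n2) * b + t * c" using eq q st by simp
  have qb: "0 < (q - n2) * b" using q pos by simp
  have "s = 0" using critical_cancel[OF crit(1) pos(1) e1] e1 qb by auto
  then have nt: "n2 * b = t * c" using st by simp
  then have "0 < t * c" using n pos by (metis nat_0_less_mult_iff)
  then have "0 < t" by simp
  have "n3 \<le> t" using critical_le[OF crit(3) \<open>0 < t\<close>, of 0 n2] nt by simp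
  moreover have "n3 \<noteq> t" using no nt by blast
  ultimately have t: "0 < t - n3" "t * c = n3 * c + (t - n3) * c"
    by (auto simp: diff_mult_distrib)
  obtain \<alpha> \<beta> where ab: "n3 * c = \<alpha> * a + \<beta> * b" using crit(3) by (auto simp: critical_def)
  have tc: "0 < (t - n3) * c" using t pos by simp
  have e2: "n2 * b = \<beta> * b + \<alpha> * a + (t - n3) * c" using nt t ab by simp
  have "\<beta> = 0" using critical_cancel[OF crit(2) pos(2) e2] e2 tc by auto
  have e3: "n1 * a = \<alpha> * a + (q - n2) * b + (t - n3) * c"
    using e1 \<open>s = 0\<close> t ab \<open>\<beta> = 0\<close> by simp
  have "\<alpha> = 0" using critical_cancel[OF crit(1) pos(1) e3] e3 qb by auto
  with ab \<open>\<beta> = 0\<close> n pos show False by simp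
qed

section \<open>Weights without coinciding critical degrees\<close>

definition noncoincident :: "nat \<Rightarrow> nat \<Rightarrow> nat \<Rightarrow> nat \<Rightarrow> nat \<Rightarrow> nat \<Rightarrow> bool" where
  "noncoincident a b c n1 n2 n3 \<longleftrightarrow>
     0 < a \<and> 0 < b \<and> 0 < c \<and>
     critical n1 a b c \<and> critical n2 b a c \<and> critical n3 c a b \<and>
     n1 * a \<noteq> n2 * b \<and> n1 * a \<noteq> n3 * c \<and> n2 * b \<noteq> n3 * c"

lemma noncoincident_perms:
  assumes "noncoincident a b c n1 n2 n3"
  shows "noncoincident a c b n1 n3 n2" "noncoincident b a c n2 n1 n3"
    "noncoincident c a b n3 n1 n2"
  using assms critical_swap unfolding noncoincident_def by metis+

lemma noncoincident_pos:
  assumes nc: "noncoincident a b c n1 n2 n3" and eq: "n1 * a = x * b + y * c"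
  shows "0 < x" "0 < y"
proof -
  have *: "0 < y" if "noncoincident a b c n1 n2 n3" "n1 * a = x * b + y * c" for a b c n1 n2 n3 x y
    using that critical_pair[of a b c n1 n2 n3 x] unfolding noncoincident_def
    by (cases "y = 0") auto
  show "0 < y" using *[OF nc eq] .
  show "0 < x" using *[OF noncoincident_perms(1)[OF nc], of y x] eq by simp
qed

text \<open>Two representations of $n_1 a$ differ by a relation between multiples of $b$ and $c$, so the larger
coefficient of $b$ is at least $n_2$. Replacing $n_2 b$ by its representation, in which $a$ occurs
with positive coefficient, contradicts the minimality of $n_1$.\<close>

lemma noncoincident_unique:
  assumes nc: "noncoincident a b c n1 n2 n3"
    and eq: "n1 * a = x * b + y * c" and eq': "n1 * a = x' * b + y' * c"
  shows "x = x'" "y = y'"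
proof -
  have pos: "0 < a" "0 < b" "0 < c" and crit: "critical n1 a b c" "critical n2 b a c"
    using nc by (auto simp: noncoincident_def)
  have no: False if lt: "x < x'" and eq: "n1 * a = x * b + y * c" and eq': "n1 * a = x' * b + y' * c"
    for x y x' y'
  proof -
    have "x * b + y * c = x' * b + y' * c" using eq eq' by simp
    moreover have xx: "x' * b = x * b + (x' - x) * b" using lt by (simp add: diff_mult_distrib)
    ultimately have "y * c = (x' - x) * b + y' * c" by simp
    then have "(x' - x) * b = 0 * a + (y - y') * c" by (simp add: diff_mult_distrib)
    then have "n2 \<le> x' - x" using critical_le[OF crit(2), of "x' - x" 0 "y - y'"] lt by simp
    then have x': "x' * b = n2 * b + (x' - n2) * b"
      by (metis add_mult_distrib diff_le_self le_add_diff_inverse le_trans)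
    obtain s t where st: "n2 * b = s * a + t * c" using crit(2) by (auto simp: critical_def)
    then have "0 < s" "0 < t" using noncoincident_pos[OF noncoincident_perms(2)[OF nc]] by auto
    have e: "n1 * a = s * a + (x' - n2) * b + (t + y') * c"
      using eq' x' st by (simp add: algebra_simps)
    have "s = n1" using critical_cancel[OF crit(1) pos(1) e] \<open>0 < s\<close> by simp
    with e \<open>0 < t\<close> pos show False by simp
  qed
  show x: "x = x'" using no[OF _ eq eq'] no[OF _ eq' eq] by (meson linorder_neqE_nat)
  show "y = y'" using eq eq' x pos by simp
qed

text \<open>Otherwise $n_1 a$ could be replaced inside the representation of $n_2 b$, which would then contain $b$
itself.\<close>

lemma noncoincident_small:
  assumes nc: "noncoincident a b c n1 n2 n3"
    and eq1: "n1 * a = x * b + y * c" and eq2: "n2 * b = s * a + t * c"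
  shows "s < n1"
proof (rule ccontr)
  assume "\<not> s < n1"
  then have s: "s * a = n1 * a + (s - n1) * a" by (simp add: diff_mult_distrib)
  have pos: "0 < a" "0 < b" "0 < c" and crit: "critical n2 b a c"
    using nc by (auto simp: noncoincident_def)
  have e: "n2 * b = x * b + (s - n1) * a + (y + t) * c"
    using eq1 eq2 s by (simp add: algebra_simps)
  have "0 < x" "0 < y" using noncoincident_pos[OF nc eq1] .
  then have "x = n2" using critical_cancel[OF crit pos(2) e] by simp
  with e \<open>0 < y\<close> pos show False by simp
qed

text \<open>Adding the three equations gives a relation between $a$, $b$, $c$ whose coefficients are the defects
of the column sums. If one defect is isolated in sign, that is, nonzero while neither of the others
has the same sign, the relation presents a positive multiple of
its weight in the semigroup of the other two; the bounds $0 < u_{ij} < n_j$ make this multiple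
smaller than the critical one.\<close>

lemma noncoincident_column_signs:
  assumes nc: "noncoincident a b c n1 n2 n3"
    and eq1: "n1 * a = u12 * b + u13 * c"
    and eq2: "n2 * b = u21 * a + u23 * c"
    and eq3: "n3 * c = u31 * a + u32 * b"
  shows "\<not> (n1 < u21 + u31 \<and> u12 + u32 \<le> n2 \<and> u13 + u23 \<le> n3)"
    and "\<not> (u21 + u31 < n1 \<and> n2 \<le> u12 + u32 \<and> n3 \<le> u13 + u23)"
proof -
  have crit: "critical n1 a b c" using nc by (auto simp: noncoincident_def)
  have tot: "n1 * a + n2 * b + n3 * c = (u21 + u31) * a + (u12 + u32) * b + (u13 + u23) * c"
    using eq1 eq2 eq3 by (simp add: algebra_simps)
  have u: "u21 < n1" "u31 < n1"
    using noncoincident_small[OF nc eq1 eq2]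
      noncoincident_small[OF noncoincident_perms(1)[OF nc], of u13 u12 u31 u32] eq1 eq3 by simp_all
  have u': "0 < u21" using noncoincident_pos[OF noncoincident_perms(2)[OF nc] eq2] by simp
  show "\<not> (n1 < u21 + u31 \<and> u12 + u32 \<le> n2 \<and> u13 + u23 \<le> n3)"
  proof
    assume h: "n1 < u21 + u31 \<and> u12 + u32 \<le> n2 \<and> u13 + u23 \<le> n3"
    then obtain e f g where efg: "u21 + u31 = n1 + e" "0 < e" "n2 = u12 + u32 + f" "n3 = u13 + u23 + g"
      by (metis le_Suc_ex less_imp_add_positive)
    have "e * a = f * b + g * c" using tot unfolding efg by (simp add: algebra_simps)
    then have "n1 \<le> e" using critical_le[OF crit efg(2)] by simp
    with efg u show False by simp
  qed
  show "\<not> (u21 + u31 < n1 \<and> n2 \<le> u12 + u32 \<and> n3 \<le> u13 + u23)"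
  proof
    assume h: "u21 + u31 < n1 \<and> n2 \<le> u12 + u32 \<and> n3 \<le> u13 + u23"
    then obtain e f g where efg: "n1 = u21 + u31 + e" "0 < e" "u12 + u32 = n2 + f" "u13 + u23 = n3 + g"
      by (metis le_Suc_ex less_imp_add_positive)
    have "e * a = f * b + g * c" using tot unfolding efg by (simp add: algebra_simps)
    then have "n1 \<le> e" using critical_le[OF crit efg(2)] by simp
    with efg u' show False by simp
  qed
qed

text \<open>A vector of three defects that is orthogonal to positive weights and in which no entry is isolated
in sign must vanish.\<close>

lemma noncoincident_column_sums:
  assumes nc: "noncoincident a b c n1 n2 n3"
    and eq1: "n1 * a = u12 * b + u13 * c"
    and eq2: "n2 * b = u21 * a + u23 * c"
    and eq3: "n3 * c = u31 * a + u32 * b"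
  shows "u21 + u31 = n1" "u12 + u32 = n2" "u13 + u23 = n3"
proof -
  have pos: "0 < a" "0 < b" "0 < c" using nc by (auto simp: noncoincident_def)
  let ?A = "u21 + u31" and ?B = "u12 + u32" and ?C = "u13 + u23"
  have tot: "n1 * a + n2 * b + n3 * c = ?A * a + ?B * b + ?C * c"
    using eq1 eq2 eq3 by (simp add: algebra_simps)
  have signs1: "\<not> (n1 < ?A \<and> ?B \<le> n2 \<and> ?C \<le> n3)" "\<not> (?A < n1 \<and> n2 \<le> ?B \<and> n3 \<le> ?C)"
    using noncoincident_column_signs[OF nc eq1 eq2 eq3] .
  have signs2: "\<not> (n2 < ?B \<and> ?A \<le> n1 \<and> ?C \<le> n3)" "\<not> (?B < n2 \<and> n1 \<le> ?A \<and> n3 \<le> ?C)"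
    using noncoincident_column_signs[OF noncoincident_perms(2)[OF nc] eq2 eq1, of u32 u31] eq3
    by (simp_all add: add.commute)
  have signs3: "\<not> (n3 < ?C \<and> ?A \<le> n1 \<and> ?B \<le> n2)" "\<not> (?C < n3 \<and> n1 \<le> ?A \<and> n2 \<le> ?B)"
    using noncoincident_column_signs[OF noncoincident_perms(3)[OF nc] eq3, of u13 u12 u23 u21] eq1 eq2
    by (simp_all add: add.commute)
  have mono: "x = x' \<and> y = y' \<and> z = z'"
    if "x \<le> x'" "y \<le> y'" "z \<le> z'" "x * a + y * b + z * c = x' * a + y' * b + z' * c" for x y z x' y' z' :: nat
  proof -
    have "x * a \<le> x' * a" "y * b \<le> y' * b" "z * c \<le> z' * c" using that by simp_all
    then have "x * a = x' * a" "y * b = y' * b" "z * c = z' * c" using that(4) by linarith+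
    then show ?thesis using pos by simp
  qed
  \<comment> \<open>If neither triple dominates the other, some coordinate is isolated in sign.\<close>
  have order: "(x \<le> x' \<and> y \<le> y' \<and> z \<le> z') \<or> (x' \<le> x \<and> y' \<le> y \<and> z' \<le> z)"
    if "\<not> (x < x' \<and> y' \<le> y \<and> z' \<le> z)" "\<not> (x' < x \<and> y \<le> y' \<and> z \<le> z')"
      "\<not> (y < y' \<and> x' \<le> x \<and> z' \<le> z)" "\<not> (y' < y \<and> x \<le> x' \<and> z \<le> z')"
      "\<not> (z < z' \<and> x' \<le> x \<and> y' \<le> y)" "\<not> (z' < z \<and> x \<le> x' \<and> y \<le> y')"
    for x y z x' y' z' :: nat
    using that by (cases "x \<le> x'"; cases "y \<le> y'"; cases "z \<le> z'") auto
  have "(n1 \<le> ?A \<and> n2 \<le> ?B \<and> n3 \<le> ?C) \<or> (?A \<le> n1 \<and> ?B \<le> n2 \<and> ?C \<le> n3)"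
    using order[OF signs1 signs2 signs3] .
  then have "n1 = ?A \<and> n2 = ?B \<and> n3 = ?C" using mono tot by metis
  then show "?A = n1" "?B = n2" "?C = n3" by simp_all
qed

text \<open>A row of critical degree is either a multiple of its diagonal unit vector or the unique off-diagonal
representation. If one row is diagonal, it exhausts its column sum; the off-diagonal representations
have positive entries in that column, so the remaining rows are diagonal as well.\<close>

lemma noncoincident_fiber:
  assumes nc: "noncoincident a b c n1 n2 n3"
    and eq1: "n1 * a = u12 * b + u13 * c"
    and eq2: "n2 * b = u21 * a + u23 * c"
    and eq3: "n3 * c = u31 * a + u32 * b"
    and row1: "m11 * a + m12 * b + m13 * c = n1 * a"
    and row2: "m21 * a + m22 * b + m23 * c = n2 * b"
    and row3: "m31 * a + m32 * b + m33 * c = n3 * c"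
    and cols: "m11 + m21 + m31 = n1" "m12 + m22 + m32 = n2" "m13 + m23 + m33 = n3"
  shows "(m11 = n1 \<and> m12 = 0 \<and> m13 = 0 \<and> m21 = 0 \<and> m22 = n2 \<and> m23 = 0 \<and> m31 = 0 \<and> m32 = 0 \<and> m33 = n3) \<or>
    (m11 = 0 \<and> m12 = u12 \<and> m13 = u13 \<and> m21 = u21 \<and> m22 = 0 \<and> m23 = u23 \<and> m31 = u31 \<and> m32 = u32 \<and> m33 = 0)"
proof -
  have row: "(s = m \<and> x = 0 \<and> y = 0) \<or> (s = 0 \<and> x = u \<and> y = v)"
    if nc: "noncoincident a b c m m' m''" and eq: "m * a = u * b + v * c"
      and r: "s * a + x * b + y * c = m * a" for a b c m m' m'' s x y u v
  proof -
    have pos: "0 < a" "0 < b" "0 < c" and crit: "critical m a b c"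
      using nc by (auto simp: noncoincident_def)
    from critical_cancel[OF crit pos(1) r[symmetric]] show ?thesis
    proof
      assume "s = m" with r pos show ?thesis by simp
    next
      assume "s = 0"
      with r have "m * a = x * b + y * c" by simp
      with \<open>s = 0\<close> noncoincident_unique[OF nc _ eq] show ?thesis by blast
    qed
  qed
  have r1: "(m11 = n1 \<and> m12 = 0 \<and> m13 = 0) \<or> (m11 = 0 \<and> m12 = u12 \<and> m13 = u13)"
    using row[OF nc eq1 row1] .
  have r2: "(m22 = n2 \<and> m21 = 0 \<and> m23 = 0) \<or> (m22 = 0 \<and> m21 = u21 \<and> m23 = u23)"
    using row[OF noncoincident_perms(2)[OF nc] eq2, of m22 m21 m23] row2 by (simp add: add.commute)
  have r3: "(m33 = n3 \<and> m31 = 0 \<and> m32 = 0) \<or> (m33 = 0 \<and> m31 = u31 \<and> m32 = u32)"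
    using row[OF noncoincident_perms(3)[OF nc] eq3, of m33 m31 m32] row3 by (simp add: algebra_simps)
  have u: "0 < u12" "0 < u13" "0 < u21" "0 < u23" "0 < u31" "0 < u32"
    using noncoincident_pos[OF nc eq1] noncoincident_pos[OF noncoincident_perms(2)[OF nc] eq2]
      noncoincident_pos[OF noncoincident_perms(3)[OF nc] eq3] by simp_all
  have n: "0 < n1" "0 < n2" "0 < n3" using nc by (auto simp: noncoincident_def critical_def)
  show ?thesis using r1 r2 r3 by (elim disjE) (use u n cols in simp_all)
qed

section \<open>Normal forms for coinciding critical degrees\<close>

text \<open>The difference of two reduced exponents of the same degree is a relation between $a$, $b$, $c$.
Whatever the signs of its coefficients, one weight has a multiple below its critical one in the
semigroup of the others. In the case where $b$ stands alone on its side this uses $n_2 b = n_1 a$ to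
trade $n_2$ copies of $b$ for $n_1$ copies of $a$.\<close>

lemma coincident_reduced_unique:
  assumes pos: "0 < a" "0 < b" "0 < c"
    and crit: "critical n1 a b c" "critical n2 b a c" "critical n3 c a b"
    and co: "n1 * a = n2 * b"
    and less: "x < n1" "x' < n1" "z < n3" "z' < n3"
    and deg: "x * a + y * b + z * c = x' * a + y' * b + z' * c"
  shows "x = x' \<and> y = y' \<and> z = z'"
proof -
  have no: False
    if zz: "z' < z" and less: "x < n1" "x' < n1" "z < n3" "z' < n3"
      and deg: "x * a + y * b + z * c = x' * a + y' * b + z' * c" for x y z x' y' z'
  proof -
    obtain e where e: "z = z' + e" "0 < e" using less_imp_add_positive[OF zz] by blast
    have en: "e < n3" using e less by simp
    consider f where "x' = x + f" | f where "x = x' + f" "0 < f"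
      by (metis le_Suc_ex less_imp_add_positive not_le)
    then show False
    proof cases
      case 1
      consider g where "y' = y + g" | g where "y = y' + g" "0 < g"
        by (metis le_Suc_ex less_imp_add_positive not_le)
      then show False
      proof cases
        case 1
        with deg e \<open>x' = x + f\<close> have "e * c = f * a + g * b" by (simp add: algebra_simps)
        from critical_le[OF crit(3) e(2) this] en show False by simp
      next
        case 2
        with deg e \<open>x' = x + f\<close> have eq: "f * a = g * b + e * c" by (simp add: algebra_simps)
        have "0 < g * b" using 2 pos by simp
        with eq have "0 < f" by (cases "f = 0") auto
        from critical_le[OF crit(1) this eq] less 1 show False by simp
      qed
    next
      case 2
      have "y < y'"
      proof (rule ccontr)
        assume "\<not> y < y'"
        then have "y' * b \<le> y * b" by simp
        moreover have "0 < e * c" using e pos by simp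
        moreover have "z * c = z' * c + e * c" "x * a = x' * a + f * a"
          using e 2 by (simp_all add: algebra_simps)
        ultimately show False using deg by linarith
      qed
      then obtain g where g: "y' = y + g" "0 < g" using less_imp_add_positive by blast
      have eq: "g * b = f * a + e * c" using deg e 2 g by (simp add: algebra_simps)
      from critical_le[OF crit(2) g(2) eq] obtain h where h: "g = n2 + h"
        using le_Suc_ex by blast
      have "f \<le> n1" using 2 less by simp
      then obtain k where k: "n1 = f + k" using le_Suc_ex by blast
      have "e * c = k * a + h * b" using eq co h k by (simp add: algebra_simps)
      from critical_le[OF crit(3) e(2) this] en show False by simp
    qed
  qed
  have z: "z = z'"
    using no[OF _ less deg] no[OF _ less(2,1,4,3) deg[symmetric]] by (meson linorder_neqE_nat)
  have nox: False if xx: "x < x'" and less: "x' < n1"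
      and deg: "x * a + y * b = x' * a + y' * b" for x y x' y'
  proof -
    obtain f where f: "x' = x + f" "0 < f" using less_imp_add_positive[OF xx] by blast
    then have "y * b = f * a + y' * b" using deg by (simp add: algebra_simps)
    then have "f * a = (y - y') * b + 0 * c" by (simp add: diff_mult_distrib)
    from critical_le[OF crit(1) f(2) this] f less show False by simp
  qed
  have deg': "x * a + y * b = x' * a + y' * b" using deg z by simp
  have "x = x'"
    using nox[OF _ less(2) deg'] nox[OF _ less(1) deg'[symmetric]] by (meson linorder_neqE_nat)
  with deg' z pos show ?thesis by simp
qed

text \<open>\<open>S\<close> stands for congruence of monomials, given by exponent triples, modulo an ideal that contains the
two binomials. Rewriting with $z^{n_3} - x^s y^t$ terminates because the $z$-exponent decreases; rewriting
with $x^{n_1} - y^{n_2}$ afterwards leaves it unchanged and decreases the $x$-exponent.\<close>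

lemma coincident_reduction:
  fixes S :: "nat \<times> nat \<times> nat \<Rightarrow> nat \<times> nat \<times> nat \<Rightarrow> bool"
  assumes pos: "0 < a" "0 < b" "0 < c"
    and crit: "critical n1 a b c" "critical n2 b a c" "critical n3 c a b"
    and co: "n1 * a = n2 * b" and rel: "n3 * c = s * a + t * b"
    and refl: "\<And>u. S u u" and sym: "\<And>u v. S u v \<Longrightarrow> S v u"
    and trans: "\<And>u v w. S u v \<Longrightarrow> S v w \<Longrightarrow> S u w"
    and step_x: "\<And>x y z. S (x + n1, y, z) (x, y + n2, z)"
    and step_z: "\<And>x y z. S (x, y, z + n3) (x + s, y + t, z)"
    and deg: "x * a + y * b + z * c = x' * a + y' * b + z' * c"
  shows "S (x, y, z) (x', y', z')"
proof -
  have n: "0 < n1" "0 < n3" using crit by (auto simp: critical_def)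
  have redz: "\<exists>x' y' z'. z' < n3 \<and> S (x, y, z) (x', y', z') \<and>
      x * a + y * b + z * c = x' * a + y' * b + z' * c" for x y z
  proof (induction z arbitrary: x y rule: less_induct)
    case (less z)
    show ?case
    proof (cases "z < n3")
      case True
      with refl show ?thesis by blast
    next
      case False
      then obtain w where w: "z = w + n3" by (metis add.commute le_Suc_ex not_less)
      with n have "w < z" by simp
      from less[OF this, of "x + s" "y + t"] obtain x' y' z' where
        *: "z' < n3" "S (x + s, y + t, w) (x', y', z')"
          "(x + s) * a + (y + t) * b + w * c = x' * a + y' * b + z' * c" by blast
      have "S (x, y, z) (x', y', z')" using trans[OF step_z *(2)] w by simp
      moreover have "x * a + y * b + z * c = x' * a + y' * b + z' * c"
        using *(3) rel w by (simp add: algebra_simps)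
      ultimately show ?thesis using *(1) by blast
    qed
  qed
  have redx: "\<exists>x' y'. x' < n1 \<and> S (x, y, z) (x', y', z) \<and> x * a + y * b = x' * a + y' * b" for x y z
  proof (induction x arbitrary: y rule: less_induct)
    case (less x)
    show ?case
    proof (cases "x < n1")
      case True
      with refl show ?thesis by blast
    next
      case False
      then obtain w where w: "x = w + n1" by (metis add.commute le_Suc_ex not_less)
      with n have "w < x" by simp
      from less[OF this, of "y + n2"] obtain x' y' where
        *: "x' < n1" "S (w, y + n2, z) (x', y', z)" "w * a + (y + n2) * b = x' * a + y' * b" by blast
      have "S (x, y, z) (x', y', z)" using trans[OF step_x *(2)] w by simp
      moreover have "x * a + y * b = x' * a + y' * b"
        using *(3) co w by (simp add: algebra_simps)
      ultimately show ?thesis using *(1) by blast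
    qed
  qed
  have red: "\<exists>x' y' z'. x' < n1 \<and> z' < n3 \<and> S (x, y, z) (x', y', z') \<and>
      x * a + y * b + z * c = x' * a + y' * b + z' * c" for x y z
  proof -
    obtain x1 y1 z1 where 1: "z1 < n3" "S (x, y, z) (x1, y1, z1)"
      "x * a + y * b + z * c = x1 * a + y1 * b + z1 * c" using redz by blast
    obtain x2 y2 where 2: "x2 < n1" "S (x1, y1, z1) (x2, y2, z1)"
      "x1 * a + y1 * b = x2 * a + y2 * b" using redx by blast
    show ?thesis using 1 2 trans[OF 1(2) 2(2)] by auto
  qed
  obtain x1 y1 z1 where 1: "x1 < n1" "z1 < n3" "S (x, y, z) (x1, y1, z1)"
    "x * a + y * b + z * c = x1 * a + y1 * b + z1 * c" using red by blast
  obtain x2 y2 z2 where 2: "x2 < n1" "z2 < n3" "S (x', y', z') (x2, y2, z2)"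
    "x' * a + y' * b + z' * c = x2 * a + y2 * b + z2 * c" using red by blast
  have "x1 = x2 \<and> y1 = y2 \<and> z1 = z2"
    using coincident_reduced_unique[OF pos crit co 1(1) 2(1) 1(2) 2(2), of y1 y2] 1(4) 2(4) deg
    by simp
  with 1(3) have "S (x, y, z) (x2, y2, z2)" by simp
  from trans[OF this sym[OF 2(3)]] show ?thesis .
qed

section \<open>Toric ideals generated by two binomials\<close>

lemma curve_kernel_iff:
  assumes "v \<in> carrier_vec (length a)"
  shows "v \<in> mat_kernel (curve_matrix a) \<longleftrightarrow> (\<Sum>j<length a. int (a ! j) * v $ j) = 0"
proof -
  have "(curve_matrix a *\<^sub>v v) $ 0 = (\<Sum>j<length a. int (a ! j) * v $ j)"
    using assms by (simp add: curve_matrix_def scalar_prod_def lessThan_atLeast0)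
  moreover have "curve_matrix a *\<^sub>v v = 0\<^sub>v 1 \<longleftrightarrow> (curve_matrix a *\<^sub>v v) $ 0 = 0"
    by (auto simp: vec_eq_iff curve_matrix_def)
  ultimately show ?thesis using assms by (simp add: mat_kernel_def curve_matrix_def)
qed

lemma monom_of_carrier: "u \<in> exponents n \<Longrightarrow> monom_of u \<in> carrier (poly_ring n)"
  by (simp add: monom_of_def poly_ring_def)

lemma monom_of_times: "monom_of u * monom_of v = monom_of (u + v)"
  by (simp add: monom_of_def mult_single)

lemma lookup_monom_of: "Poly_Mapping.lookup (monom_of u) v = (if u = v then 1 else 0)"
  by (simp add: monom_of_def lookup_single when_def)

lemma poly_ring_simps:
  "x \<otimes>\<^bsub>poly_ring n\<^esub> y = x * y" "x \<oplus>\<^bsub>poly_ring n\<^esub> y = x + y" "\<zero>\<^bsub>poly_ring n\<^esub> = 0"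
  by (simp_all add: poly_ring_def)

lemma binomial_carrier:
  assumes "u \<in> exponents n" "w \<in> exponents n"
  shows "monom_of u - monom_of w \<in> carrier (poly_ring n)"
proof -
  have "Poly_Mapping.keys (monom_of u - monom_of w :: (nat \<Rightarrow>\<^sub>0 nat) \<Rightarrow>\<^sub>0 'a) \<subseteq> {u, w}"
    by (auto simp: in_keys_iff lookup_minus lookup_monom_of split: if_splits)
  with assms show ?thesis by (auto simp: poly_ring_def)
qed

lemma binomial_in_ideal:
  fixes I :: "((nat \<Rightarrow>\<^sub>0 nat) \<Rightarrow>\<^sub>0 'k::field) set"
  assumes I: "ideal I (poly_ring n)"
  shows binomial_in_ideal_refl: "monom_of u - monom_of u \<in> I"
    and binomial_in_ideal_trans: "monom_of u - monom_of v \<in> I \<Longrightarrow> monom_of v - monom_of w \<in> I \<Longrightarrow>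
      monom_of u - monom_of w \<in> I"
    and binomial_in_ideal_sym: "monom_of u - monom_of v \<in> I \<Longrightarrow> monom_of v - monom_of u \<in> I"
    and binomial_in_ideal_add: "t \<in> exponents n \<Longrightarrow> monom_of u - monom_of v \<in> I \<Longrightarrow>
      monom_of (t + u) - monom_of (t + v) \<in> I"
proof -
  note sub = ideal.axioms(1)[OF I]
  show "monom_of u - monom_of u \<in> I" using additive_subgroup.zero_closed[OF sub] by (simp add: poly_ring_simps)
  show "monom_of u - monom_of w \<in> I" if "monom_of u - monom_of v \<in> I" "monom_of v - monom_of w \<in> I"
    using additive_subgroup.a_closed[OF sub that] by (simp add: poly_ring_simps)
  show "monom_of v - monom_of u \<in> I" if "monom_of u - monom_of v \<in> I"
  proof -
    have "Poly_Mapping.keys (- 1 :: (nat \<Rightarrow>\<^sub>0 nat) \<Rightarrow>\<^sub>0 'k) = Poly_Mapping.keys (1 :: (nat \<Rightarrow>\<^sub>0 nat) \<Rightarrow>\<^sub>0 'k)"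
      by (simp add: Poly_Mapping.keys.rep_eq uminus_poly_mapping.rep_eq)
    then have "- 1 \<in> carrier (poly_ring n :: ((nat \<Rightarrow>\<^sub>0 nat) \<Rightarrow>\<^sub>0 'k) ring)"
      by (simp add: poly_ring_def exponents_def)
    from ideal.I_l_closed[OF I that this] show ?thesis by (simp add: poly_ring_simps)
  qed
  show "monom_of (t + u) - monom_of (t + v) \<in> I" if "t \<in> exponents n" "monom_of u - monom_of v \<in> I"
    using ideal.I_l_closed[OF I that(2) monom_of_carrier[OF that(1)]]
    by (simp add: poly_ring_simps right_diff_distrib monom_of_times)
qed

text \<open>The positions \<open>p\<close>, \<open>q\<close>, \<open>r\<close> are an arbitrary arrangement of the three variables, so that the lemma
covers each of the three possible coincidences.\<close>

lemma complete_intersection_if_coincident: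
  fixes d :: "nat list"
  assumes len: "length d = 3" and pqr: "distinct [p, q, r]" "set [p, q, r] = {..<3}"
    and pos: "0 < d ! p" "0 < d ! q" "0 < d ! r"
    and crit: "critical n1 (d ! p) (d ! q) (d ! r)" "critical n2 (d ! q) (d ! p) (d ! r)"
      "critical n3 (d ! r) (d ! p) (d ! q)"
    and co: "n1 * d ! p = n2 * d ! q"
  shows "complete_intersection TYPE('k::field) d"
proof -
  let ?R = "poly_ring 3 :: ((nat \<Rightarrow>\<^sub>0 nat) \<Rightarrow>\<^sub>0 'k) ring"
  \<comment> \<open>The exponent vector with the entries x, y, z at the positions p, q, r.\<close>
  define E :: "nat \<times> nat \<times> nat \<Rightarrow> nat \<Rightarrow>\<^sub>0 nat" where
    "E = (\<lambda>(x, y, z). Poly_Mapping.single p x + Poly_Mapping.single q y + Poly_Mapping.single r z)"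
  have lookup_E: "Poly_Mapping.lookup (E (x, y, z)) p = x" "Poly_Mapping.lookup (E (x, y, z)) q = y"
    "Poly_Mapping.lookup (E (x, y, z)) r = z" for x y z
    using pqr(1) by (simp_all add: E_def lookup_add lookup_single when_def)
  have lookup_E': "Poly_Mapping.lookup (E (x, y, z)) i = 0" if "i \<notin> {..<3}" for x y z i
    using that pqr(2) by (auto simp: E_def lookup_add lookup_single when_def)
  have E_exp: "E u \<in> exponents 3" for u
    using lookup_E'[of _ "fst u" "fst (snd u)" "snd (snd u)"] by (auto simp: exponents_def in_keys_iff)
  have E_add: "E (x, y, z) + E (x', y', z') = E (x + x', y + y', z + z')" for x y z x' y' z'
    by (simp add: E_def single_add algebra_simps)
  have E_all: "\<exists>x y z. u = E (x, y, z)" if "u \<in> exponents 3" for u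
  proof (intro exI poly_mapping_eqI)
    fix i
    let ?v = "E (Poly_Mapping.lookup u p, Poly_Mapping.lookup u q, Poly_Mapping.lookup u r)"
    show "Poly_Mapping.lookup u i = Poly_Mapping.lookup ?v i"
    proof (cases "i < 3")
      case True
      then have "i \<in> set [p, q, r]" using pqr(2) by simp
      then show ?thesis by (auto simp: lookup_E)
    next
      case False
      then have "i \<notin> Poly_Mapping.keys u" using that by (auto simp: exponents_def)
      with False show ?thesis by (simp add: lookup_E' in_keys_iff)
    qed
  qed
  have sum3: "(\<Sum>i<length d. f i) = f p + f q + f r" for f :: "nat \<Rightarrow> int"
    unfolding len pqr(2)[symmetric] using pqr(1) by simp
  have ker: "exponent_diff 3 (E (x, y, z)) (E (x', y', z')) \<in> mat_kernel (curve_matrix d) \<longleftrightarrow>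
      x * d ! p + y * d ! q + z * d ! r = x' * d ! p + y' * d ! q + z' * d ! r" for x y z x' y' z'
  proof -
    have c: "exponent_diff 3 (E (x, y, z)) (E (x', y', z')) \<in> carrier_vec (length d)"
      by (simp add: exponent_diff_def len)
    have i: "p < 3" "q < 3" "r < 3" using pqr(2) by auto
    have "exponent_diff 3 (E (x, y, z)) (E (x', y', z')) \<in> mat_kernel (curve_matrix d) \<longleftrightarrow>
      int (d ! p) * (int x - int x') + int (d ! q) * (int y - int y') + int (d ! r) * (int z - int z') = 0"
      unfolding curve_kernel_iff[OF c] sum3 using i by (simp add: exponent_diff_def lookup_E)
    also have "\<dots> \<longleftrightarrow> int (x * d ! p + y * d ! q + z * d ! r) = int (x' * d ! p + y' * d ! q + z' * d ! r)"
      by (simp add: algebra_simps)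
    finally show ?thesis by (simp only: of_nat_eq_iff)
  qed
  obtain s t where st: "n3 * d ! r = s * d ! p + t * d ! q" using crit(3) by (auto simp: critical_def)
  have n: "0 < n1" "0 < n2" "0 < n3" using crit by (auto simp: critical_def)
  define g1 g2 :: "(nat \<Rightarrow>\<^sub>0 nat) \<Rightarrow>\<^sub>0 'k" where
    "g1 = monom_of (E (n1, 0, 0)) - monom_of (E (0, n2, 0))" and
    "g2 = monom_of (E (0, 0, n3)) - monom_of (E (s, t, 0))"
  define B :: "((nat \<Rightarrow>\<^sub>0 nat) \<Rightarrow>\<^sub>0 'k) set" where
    "B = {monom_of u - monom_of w | u w. u \<in> exponents 3 \<and> w \<in> exponents 3 \<and>
       exponent_diff 3 u w \<in> mat_kernel (curve_matrix d)}"
  have toric: "toric_ideal (curve_matrix d) = Idl\<^bsub>?R\<^esub> B"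
    by (simp add: toric_ideal_def B_def curve_matrix_def len)
  have ring: "ring ?R" using cring_poly_ring cring.axioms(1) by blast
  have carr: "{g1, g2} \<subseteq> carrier ?R" "B \<subseteq> carrier ?R"
    by (auto simp: g1_def g2_def B_def intro!: binomial_carrier E_exp)
  note idG = ring.genideal_ideal[OF ring carr(1)] and idB = ring.genideal_ideal[OF ring carr(2)]
  let ?I = "Idl\<^bsub>?R\<^esub> {g1, g2}"
  have gI: "g1 \<in> ?I" "g2 \<in> ?I" using ring.genideal_self[OF ring carr(1)] by auto
  have in_B: "monom_of (E (x, y, z)) - monom_of (E (x', y', z')) \<in> B"
    if "x * d ! p + y * d ! q + z * d ! r = x' * d ! p + y' * d ! q + z' * d ! r" for x y z x' y' z'
    unfolding B_def using E_exp ker[THEN iffD2, OF that] by blast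
  have "{g1, g2} \<subseteq> B" unfolding g1_def g2_def using in_B[of n1 0 0 0 n2 0] in_B[of 0 0 n3 s t 0] co st
    by simp
  then have "{g1, g2} \<subseteq> Idl\<^bsub>?R\<^esub> B" using ring.genideal_self[OF ring carr(2)] by blast
  then have sub1: "?I \<subseteq> Idl\<^bsub>?R\<^esub> B" using ring.genideal_minimal[OF ring idB] by blast
  define S where "S u v \<longleftrightarrow> (monom_of (E u) - monom_of (E v) :: (nat \<Rightarrow>\<^sub>0 nat) \<Rightarrow>\<^sub>0 'k) \<in> ?I" for u v
  have S: "S (x, y, z) (x', y', z')"
    if "x * d ! p + y * d ! q + z * d ! r = x' * d ! p + y' * d ! q + z' * d ! r" for x y z x' y' z'
  proof (rule coincident_reduction[OF pos crit co st _ _ _ _ _ that, of S])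
    show "S u u" for u unfolding S_def by (rule binomial_in_ideal_refl[OF idG])
    show "S v u" if "S u v" for u v
      using that unfolding S_def by (rule binomial_in_ideal_sym[OF idG])
    show "S u w" if "S u v" "S v w" for u v w
      using that unfolding S_def by (rule binomial_in_ideal_trans[OF idG])
    show "S (x + n1, y, z) (x, y + n2, z)" for x y z
      using binomial_in_ideal_add[OF idG E_exp, of "E (n1, 0, 0)" "E (0, n2, 0)" "(x, y, z)"] gI(1)
      unfolding S_def g1_def by (simp add: E_add)
    show "S (x, y, z + n3) (x + s, y + t, z)" for x y z
      using binomial_in_ideal_add[OF idG E_exp, of "E (0, 0, n3)" "E (s, t, 0)" "(x, y, z)"] gI(2)
      unfolding S_def g2_def by (simp add: E_add)
  qed
  have "B \<subseteq> ?I"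
  proof
    fix f assume "f \<in> B"
    then obtain u w where f: "f = monom_of u - monom_of w" and uw: "u \<in> exponents 3" "w \<in> exponents 3"
      and k: "exponent_diff 3 u w \<in> mat_kernel (curve_matrix d)" unfolding B_def by blast
    obtain x y z where u: "u = E (x, y, z)" using E_all[OF uw(1)] by blast
    obtain x' y' z' where w: "w = E (x', y', z')" using E_all[OF uw(2)] by blast
    from k show "f \<in> ?I" using S unfolding f u w ker S_def by blast
  qed
  then have sub2: "Idl\<^bsub>?R\<^esub> B \<subseteq> ?I" using ring.genideal_minimal[OF ring idG] by blast
  \<comment> \<open>The two generators are distinct: only the second contains the pure power of variable r.\<close>
  have "E (n1, 0, 0) \<noteq> E (0, 0, n3)" "E (0, n2, 0) \<noteq> E (0, 0, n3)" "E (s, t, 0) \<noteq> E (0, 0, n3)"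
    using lookup_E(3) n by (metis less_irrefl)+
  then have "Poly_Mapping.lookup g1 (E (0, 0, n3)) \<noteq> Poly_Mapping.lookup g2 (E (0, 0, n3))"
    by (simp add: g1_def g2_def lookup_minus lookup_monom_of)
  then have "card {g1, g2} = 2" by (auto simp: card_insert_if)
  with carr(1) sub1 sub2 toric show ?thesis
    unfolding complete_intersection_def len by (intro exI[of _ "{g1, g2}"]) auto
qed

section \<open>Dickson's lemma and the Graver basis\<close>

text \<open>A monotone subsequence that decreases is eventually constant, because its values have a minimum.\<close>

lemma nat_seq_mono_subseq:
  fixes s :: "nat \<Rightarrow> nat"
  shows "\<exists>g :: nat \<Rightarrow> nat. strict_mono g \<and> mono (\<lambda>m. s (g m))"
proof -
  obtain f where f: "strict_mono f" and m: "monoseq (\<lambda>n. s (f n))" using seq_monosub by blast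
  show ?thesis
  proof (cases "mono (\<lambda>n. s (f n))")
    case True with f show ?thesis by (intro exI[of _ f]) simp
  next
    case False
    with m have dec: "\<And>i j. i \<le> j \<Longrightarrow> s (f j) \<le> s (f i)"
      by (auto simp: monoseq_def mono_def)
    obtain n where n: "\<And>i. s (f n) \<le> s (f i)"
      using ex_has_least_nat[of "\<lambda>_. True" 0 "\<lambda>i. s (f i)"] by auto
    have "s (f (n + i)) = s (f n)" for i using dec[of n "n + i"] n[of "n + i"] by simp
    moreover have "strict_mono (\<lambda>i. f (n + i))" using f by (simp add: strict_mono_def)
    ultimately show ?thesis by (intro exI[of _ "\<lambda>i. f (n + i)"]) (simp add: mono_def)
  qed
qed

text \<open>Dickson's lemma: every sequence in $\mathbb{N}^K$ has a subsequence that is nondecreasing in every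
coordinate. The coordinates are treated one after the other.\<close>

lemma dickson_subseq:
  fixes h :: "nat \<Rightarrow> nat \<Rightarrow> nat"
  shows "\<exists>g :: nat \<Rightarrow> nat. strict_mono g \<and> (\<forall>t<K. mono (\<lambda>m. h (g m) t))"
proof (induction K)
  case 0
  show ?case by (intro exI[of _ id]) (simp add: strict_mono_def)
next
  case (Suc K)
  then obtain g :: "nat \<Rightarrow> nat" where g: "strict_mono g" "\<forall>t<K. mono (\<lambda>m. h (g m) t)" by blast
  obtain f :: "nat \<Rightarrow> nat" where f: "strict_mono f" "mono (\<lambda>m. h (g (f m)) K)"
    using nat_seq_mono_subseq[of "\<lambda>m. h (g m) K"] by blast
  have "mono (\<lambda>m. h (g (f m)) t)" if "t < K" for t
    using g(2) that strict_mono_mono[OF f(1)] by (simp add: mono_def)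
  with f g show ?case
    by (intro exI[of _ "\<lambda>m. g (f m)"]) (auto simp: less_Suc_eq strict_mono_def)
qed

definition conformal :: "nat \<Rightarrow> int vec \<Rightarrow> int vec \<Rightarrow> bool" where
  "conformal N x y \<longleftrightarrow> (\<forall>i<N. (0 \<le> x $ i \<and> x $ i \<le> y $ i) \<or> (y $ i \<le> x $ i \<and> x $ i \<le> 0))"

text \<open>The Graver basis, with both signs of each element: the nonzero kernel elements that are minimal in
the conformal order.\<close>

definition graver :: "int mat \<Rightarrow> int vec set" where
  "graver M = {x \<in> mat_kernel M. x \<noteq> 0\<^sub>v (dim_col M) \<and>
     (\<forall>y \<in> mat_kernel M. y \<noteq> 0\<^sub>v (dim_col M) \<longrightarrow> conformal (dim_col M) y x \<longrightarrow> y = x)}"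

text \<open>The conformal order on $\mathbb{Z}^N$ is the componentwise order on the pairs of positive and negative
parts in $\mathbb{N}^{2N}$. By Dickson's lemma it has no infinite antichain.\<close>

lemma finite_graver: "finite (graver M)"
proof (rule ccontr)
  let ?N = "dim_col M"
  assume "infinite (graver M)"
  then obtain f :: "nat \<Rightarrow> int vec" where f: "inj f" "range f \<subseteq> graver M"
    using infinite_countable_subset by blast
  define h where "h m t = (if t < ?N then nat (f m $ t) else nat (- (f m $ (t - ?N))))" for m t
  obtain g :: "nat \<Rightarrow> nat" where g: "strict_mono g" "\<forall>t<2 * ?N. mono (\<lambda>m. h (g m) t)"
    using dickson_subseq by blast
  have "conformal ?N (f (g 0)) (f (g 1))"
    unfolding conformal_def
  proof (intro allI impI)
    fix i assume i: "i < ?N"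
    have "h (g 0) i \<le> h (g 1) i" "h (g 0) (?N + i) \<le> h (g 1) (?N + i)"
      using g(2) i by (simp_all add: mono_def)
    then have "nat (f (g 0) $ i) \<le> nat (f (g 1) $ i)" "nat (- f (g 0) $ i) \<le> nat (- f (g 1) $ i)"
      using i by (simp_all add: h_def)
    then show "(0 \<le> f (g 0) $ i \<and> f (g 0) $ i \<le> f (g 1) $ i) \<or>
        (f (g 1) $ i \<le> f (g 0) $ i \<and> f (g 0) $ i \<le> 0)"
      by linarith
  qed
  moreover have "f (g 0) \<in> graver M" "f (g 1) \<in> graver M" using f by auto
  ultimately have "f (g 0) = f (g 1)" by (auto simp: graver_def)
  then have "g 0 = g 1" using f by (simp add: inj_eq)
  with strict_mono_eq[OF g(1)] show False by simp
qed

definition l1 :: "nat \<Rightarrow> int vec \<Rightarrow> nat" where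
  "l1 N x = (\<Sum>i<N. nat \<bar>x $ i\<bar>)"

lemma l1_zero:
  assumes "x \<in> carrier_vec N" "l1 N x = 0" shows "x = 0\<^sub>v N"
  using assms by (auto simp: l1_def)

lemma mat_kernel_carrier: "x \<in> mat_kernel M \<Longrightarrow> x \<in> carrier_vec (dim_col M)"
  by (simp add: mat_kernel_def)

lemma zero_mat_kernel: "0\<^sub>v (dim_col M) \<in> mat_kernel M"
  by (auto simp: mat_kernel_def intro!: eq_vecI)

lemma mat_kernel_minus:
  fixes M :: "int mat"
  assumes "x \<in> mat_kernel M" "y \<in> mat_kernel M"
  shows "x - y \<in> mat_kernel M"
proof -
  have "M *\<^sub>v (x - y) = M *\<^sub>v x - M *\<^sub>v y"
    using assms by (intro mult_minus_distrib_mat_vec[of _ "dim_row M" "dim_col M"]) (auto simp: mat_kernel_def)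
  then show ?thesis using assms by (auto simp: mat_kernel_def)
qed

lemma conformal_l1:
  assumes "conformal N y x" "x \<in> carrier_vec N" "y \<in> carrier_vec N"
  shows "l1 N x = l1 N y + l1 N (x - y)"
proof -
  have "nat \<bar>x $ i\<bar> = nat \<bar>y $ i\<bar> + nat \<bar>(x - y) $ i\<bar>" if i: "i < N" for i
  proof -
    have "(x - y) $ i = x $ i - y $ i" using assms i by simp
    moreover have "(0 \<le> y $ i \<and> y $ i \<le> x $ i) \<or> (x $ i \<le> y $ i \<and> y $ i \<le> 0)"
      using assms(1) i by (simp add: conformal_def)
    ultimately have "\<bar>x $ i\<bar> = \<bar>y $ i\<bar> + \<bar>(x - y) $ i\<bar>" by auto
    then show ?thesis by (simp only: nat_add_distrib abs_ge_zero)
  qed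
  then show ?thesis unfolding l1_def sum.distrib[symmetric] by (intro sum.cong) auto
qed

lemma conformal_trans: "conformal N x y \<Longrightarrow> conformal N y z \<Longrightarrow> conformal N x z"
  unfolding conformal_def by fastforce

lemma conformal_graver_exists:
  assumes "x \<in> mat_kernel M" "x \<noteq> 0\<^sub>v (dim_col M)"
  shows "\<exists>y \<in> graver M. conformal (dim_col M) y x"
  using assms
proof (induction "l1 (dim_col M) x" arbitrary: x rule: less_induct)
  case less
  let ?N = "dim_col M"
  show ?case
  proof (cases "x \<in> graver M")
    case True
    moreover have "conformal ?N x x" by (auto simp: conformal_def)
    ultimately show ?thesis by blast
  next
    case False
    with less.prems obtain y where y: "y \<in> mat_kernel M" "y \<noteq> 0\<^sub>v ?N" "conformal ?N y x" "y \<noteq> x"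
      by (auto simp: graver_def)
    note c = mat_kernel_carrier[OF less.prems(1)] mat_kernel_carrier[OF y(1)]
    have "x - y \<noteq> 0\<^sub>v ?N"
    proof
      assume *: "x - y = 0\<^sub>v ?N"
      have "y = x"
      proof (rule eq_vecI)
        fix i assume "i < dim_vec x"
        then have i: "i < ?N" using c by simp
        then have "(x - y) $ i = 0" using * by simp
        then show "y $ i = x $ i" using i c by simp
      qed (use c in simp)
      with y show False by simp
    qed
    then have "l1 ?N (x - y) \<noteq> 0" using l1_zero c by (metis minus_carrier_vec)
    then have "l1 ?N y < l1 ?N x" using conformal_l1[OF y(3) c] by simp
    from less.hyps[OF this y(1,2)] y(3) show ?thesis using conformal_trans by blast
  qed
qed

lemma vec_sum_Nil [simp]: "vec_sum N [] = 0\<^sub>v N"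
  and vec_sum_Cons [simp]: "vec_sum N (v # vs) = v + vec_sum N vs"
  by (simp_all add: vec_sum_def)

lemma vec_sum_carrier: "set vs \<subseteq> carrier_vec N \<Longrightarrow> vec_sum N vs \<in> carrier_vec N"
  by (induction vs) auto

lemma diff_diff_add_vec:
  fixes w g s :: "'a :: ab_group_add vec"
  assumes "w \<in> carrier_vec N" "g \<in> carrier_vec N" "s \<in> carrier_vec N"
  shows "w - (g + s) = w - g - s"
  using assms by (intro eq_vecI) auto

text \<open>Subtracting from $w$ a Graver element that is conformal to $w - u$ moves every coordinate from $w_i$
towards $u_i$ without passing it, so nonnegativity is kept and the distance to $u$ decreases.\<close>

lemma graver_steps:
  assumes "w \<in> nonneg_vecs (dim_col M)" "u \<in> nonneg_vecs (dim_col M)" "w - u \<in> mat_kernel M"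
  shows "\<exists>vs. set vs \<subseteq> graver M \<and> w - u = vec_sum (dim_col M) vs \<and>
    (\<forall>p \<le> length vs. w - vec_sum (dim_col M) (take p vs) \<in> nonneg_vecs (dim_col M))"
  using assms
proof (induction "l1 (dim_col M) (w - u)" arbitrary: w rule: less_induct)
  case less
  let ?N = "dim_col M"
  have c: "w \<in> carrier_vec ?N" "u \<in> carrier_vec ?N" using less.prems by (auto simp: nonneg_vecs_def)
  show ?case
  proof (cases "w - u = 0\<^sub>v ?N")
    case True
    with less.prems c show ?thesis by (intro exI[of _ "[]"]) auto
  next
    case False
    then obtain g where g: "g \<in> graver M" "conformal ?N g (w - u)"
      using conformal_graver_exists[OF less.prems(3)] by blast
    have gk: "g \<in> mat_kernel M" "g \<noteq> 0\<^sub>v ?N" using g by (auto simp: graver_def)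
    have cg: "g \<in> carrier_vec ?N" using mat_kernel_carrier[OF gk(1)] .
    have w': "w - g \<in> nonneg_vecs ?N"
      unfolding nonneg_vecs_def
    proof (intro CollectI conjI allI impI)
      fix i assume i: "i < ?N"
      then have "0 \<le> w $ i" "0 \<le> u $ i" using less.prems by (auto simp: nonneg_vecs_def)
      moreover have "(0 \<le> g $ i \<and> g $ i \<le> w $ i - u $ i) \<or> (w $ i - u $ i \<le> g $ i \<and> g $ i \<le> 0)"
        using g(2) i c by (simp add: conformal_def)
      ultimately show "0 \<le> (w - g) $ i" using i cg by simp linarith
    qed (use c cg in simp)
    have comm: "w - g - u = w - u - g" using c cg by (intro eq_vecI) auto
    have k: "w - g - u \<in> mat_kernel M"
      unfolding comm using mat_kernel_minus[OF less.prems(3) gk(1)] .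
    have "l1 ?N g \<noteq> 0" using l1_zero[OF cg] gk(2) by blast
    then have "l1 ?N (w - g - u) < l1 ?N (w - u)"
      unfolding comm using conformal_l1[OF g(2) _ cg] c by simp
    from less.hyps[OF this w' less.prems(2) k] obtain vs where vs: "set vs \<subseteq> graver M"
      "w - g - u = vec_sum ?N vs"
      "\<forall>p \<le> length vs. w - g - vec_sum ?N (take p vs) \<in> nonneg_vecs ?N" by blast
    have cvs: "set vs \<subseteq> carrier_vec ?N"
      using vs(1) by (auto simp: graver_def mat_kernel_def)
    show ?thesis
    proof (intro exI[of _ "g # vs"] conjI allI impI)
      show "set (g # vs) \<subseteq> graver M" using g vs by simp
      have "w - u = g + (w - g - u)" using c cg by (intro eq_vecI) auto
      then show "w - u = vec_sum ?N (g # vs)" using vs by simp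
      fix p assume p: "p \<le> length (g # vs)"
      show "w - vec_sum ?N (take p (g # vs)) \<in> nonneg_vecs ?N"
      proof (cases p)
        case 0
        with c less.prems show ?thesis by simp
      next
        case (Suc q)
        have "set (take q vs) \<subseteq> carrier_vec ?N" using cvs set_take_subset by fast
        then have "w - vec_sum ?N (take p (g # vs)) = w - g - vec_sum ?N (take q vs)"
          using Suc diff_diff_add_vec[OF c(1) cg vec_sum_carrier] by simp
        with vs(3) p Suc show ?thesis by simp
      qed
    qed
  qed
qed

lemma graver_is_markov_basis: "is_markov_basis M (graver M)"
  unfolding is_markov_basis_def
proof (intro conjI ballI impI)
  show "finite (graver M)" by (rule finite_graver)
  show "graver M \<subseteq> mat_kernel M" by (auto simp: graver_def)
  fix w u assume "w \<in> nonneg_vecs (dim_col M)" "u \<in> nonneg_vecs (dim_col M)" "w - u \<in> mat_kernel M"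
  from graver_steps[OF this] show "\<exists>vs. set vs \<subseteq> graver M \<union> uminus ` graver M \<and>
              w - u = vec_sum (dim_col M) vs \<and>
              (\<forall>p \<in> {1..length vs}.
                 w - vec_sum (dim_col M) (take p vs) \<in> nonneg_vecs (dim_col M))"
    by (metis atLeastAtMost_iff le_supI1)
qed

lemma minimal_markov_basis_exists: "\<exists>B. is_minimal_markov_basis M B"
proof -
  obtain B where B: "is_markov_basis M B" "\<And>B'. is_markov_basis M B' \<Longrightarrow> card B \<le> card B'"
    using ex_has_least_nat[of "is_markov_basis M" _ card] graver_is_markov_basis by metis
  have "\<not> is_markov_basis M B'" if "B' \<subset> B" for B'
  proof -
    have "finite B" using B(1) by (simp add: is_markov_basis_def)
    then have "card B' < card B" using that psubset_card_mono by blast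
    then show ?thesis using B(2) by (meson not_less)
  qed
  with B(1) show ?thesis by (auto simp: is_minimal_markov_basis_def)
qed

section \<open>Two-element fibres\<close>

text \<open>All intermediate points of a path from $w$ to $u$ lie in the fibre $\{w, u\}$, so the step that
reaches $u$ for the first time equals $w - u$.\<close>

lemma indispensable:
  assumes w: "w \<in> nonneg_vecs (dim_col M)" and u: "u \<in> nonneg_vecs (dim_col M)"
    and wu: "w - u \<in> mat_kernel M" "w \<noteq> u"
    and fib: "\<And>y. y \<in> nonneg_vecs (dim_col M) \<Longrightarrow> w - y \<in> mat_kernel M \<Longrightarrow> y = w \<or> y = u"
    and B: "is_markov_basis M B"
  shows "w - u \<in> B \<or> - (w - u) \<in> B"
proof -
  let ?N = "dim_col M"
  have c: "w \<in> carrier_vec ?N" "u \<in> carrier_vec ?N" using w u by (auto simp: nonneg_vecs_def)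
  obtain vs where vs: "set vs \<subseteq> B \<union> uminus ` B" "w - u = vec_sum ?N vs"
      "\<forall>p \<in> {1..length vs}. w - vec_sum ?N (take p vs) \<in> nonneg_vecs ?N"
    using B w u wu unfolding is_markov_basis_def by blast
  have Bk: "B \<subseteq> mat_kernel M" using B by (simp add: is_markov_basis_def)
  have neg: "- x \<in> mat_kernel M" if "x \<in> mat_kernel M" for x
  proof -
    have "0\<^sub>v ?N - x = - x" using mat_kernel_carrier[OF that] by auto
    with mat_kernel_minus[OF zero_mat_kernel that] show ?thesis by simp
  qed
  have vk: "set vs \<subseteq> mat_kernel M" using vs(1) Bk neg by auto
  have cvs: "set vs \<subseteq> carrier_vec ?N" using vk mat_kernel_carrier by blast
  have sumk: "vec_sum ?N xs \<in> mat_kernel M" if "set xs \<subseteq> mat_kernel M" for xs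
    using that
  proof (induction xs)
    case Nil
    show ?case using zero_mat_kernel by simp
  next
    case (Cons x xs)
    have e: "x + vec_sum ?N xs = x - (- vec_sum ?N xs)"
      by (intro eq_vecI) auto
    show ?case unfolding vec_sum_Cons e using Cons neg mat_kernel_minus by simp
  qed
  let ?y = "\<lambda>p. w - vec_sum ?N (take p vs)"
  have y: "?y p = w \<or> ?y p = u" if "p \<le> length vs" for p
  proof (cases "p = 0")
    case True
    with c show ?thesis by simp
  next
    case False
    with that vs(3) have nn: "?y p \<in> nonneg_vecs ?N" by simp
    have t: "set (take p vs) \<subseteq> mat_kernel M" using vk set_take_subset by fast
    have "vec_sum ?N (take p vs) \<in> carrier_vec ?N" using sumk[OF t] mat_kernel_carrier by blast
    then have "w - ?y p = vec_sum ?N (take p vs)" using c by (intro eq_vecI) auto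
    with fib[OF nn] sumk[OF t] show ?thesis by simp
  qed
  have "?y (length vs) = w - (w - u)" using vs(2) by simp
  also have "\<dots> = u" using c by (intro eq_vecI) auto
  finally have last: "?y (length vs) = u" .
  define p where "p = (LEAST p. ?y p = u)"
  have p: "?y p = u" "p \<le> length vs"
    unfolding p_def
    by (rule LeastI[of "\<lambda>p. ?y p = u", OF last], rule Least_le[of "\<lambda>p. ?y p = u", OF last])
  have "p \<noteq> 0" using p(1) wu(2) c by auto
  then obtain q where q: "p = Suc q" using not0_implies_Suc by blast
  have "?y q \<noteq> u" using not_less_Least[of q "\<lambda>p. ?y p = u"] q unfolding p_def by simp
  with y[of q] p q have yq: "?y q = w" by simp
  have ql: "q < length vs" using p q by simp
  have ct: "vec_sum ?N (take q vs) \<in> carrier_vec ?N"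
    using cvs set_take_subset by (intro vec_sum_carrier) fast
  have cv: "vs ! q \<in> carrier_vec ?N" using cvs ql nth_mem by blast
  have snoc: "vec_sum ?N (xs @ [v]) = vec_sum ?N xs + v"
    if "set xs \<subseteq> carrier_vec ?N" "v \<in> carrier_vec ?N" for xs v
    using that
  proof (induction xs)
    case (Cons x xs)
    then show ?case using vec_sum_carrier[of xs ?N] by (simp add: assoc_add_vec[of _ ?N])
  qed simp
  have "set (take q vs) \<subseteq> carrier_vec ?N" using cvs set_take_subset by fast
  then have "?y p = ?y q - vs ! q"
    using q ql take_Suc_conv_app_nth[OF ql] snoc[OF _ cv] diff_diff_add_vec[OF c(1) ct cv] by simp
  then have "u = w - vs ! q" using p yq by simp
  then have v: "w - u = vs ! q" using c cv by (intro eq_vecI) auto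
  have "vs ! q \<in> B \<union> uminus ` B" using vs(1) ql nth_mem by blast
  with v show ?thesis by auto
qed

section \<open>Kernels of Lawrence liftings\<close>

lemma dim_diag_block_replicate:
  "dim_row (diag_block_mat (replicate r A)) = r * dim_row A"
  "dim_col (diag_block_mat (replicate r A)) = r * dim_col A"
  by (simp_all add: dim_diag_block_mat sum_list_replicate)

lemma index_diag_block_replicate:
  assumes "i < r * dim_row A" "j < r * dim_col A"
  shows "diag_block_mat (replicate r A) $$ (i, j) =
    (if i div dim_row A = j div dim_col A then A $$ (i mod dim_row A, j mod dim_col A) else 0)"
  using assms
proof (induction r arbitrary: i j)
  case (Suc r)
  let ?R = "dim_row A" and ?C = "dim_col A"
  have pos: "0 < ?R" "0 < ?C" using Suc.prems by (cases "?R = 0"; cases "?C = 0"; simp)+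
  have e: "diag_block_mat (replicate (Suc r) A) $$ (i, j) =
      (if i < ?R then if j < ?C then A $$ (i, j) else 0
       else if j < ?C then 0 else diag_block_mat (replicate r A) $$ (i - ?R, j - ?C))"
    using Suc.prems by (simp add: Let_def dim_diag_block_replicate)
  show ?case
  proof (cases "i < ?R \<or> j < ?C")
    case True
    then show ?thesis unfolding e using pos by (auto simp: div_eq_0_iff)
  next
    case False
    then have "i - ?R < r * ?R" "j - ?C < r * ?C" using Suc.prems by auto
    moreover have "i div ?R = Suc ((i - ?R) div ?R)" "j div ?C = Suc ((j - ?C) div ?C)"
      "i mod ?R = (i - ?R) mod ?R" "j mod ?C = (j - ?C) mod ?C"
      using False pos by (auto simp: le_div_geq le_mod_geq)
    ultimately show ?thesis unfolding e using False Suc.IH by simp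
  qed
qed simp

lemma dim_lawrence_lifting:
  "dim_row (lawrence_lifting r A) = r * dim_row A + dim_col A"
  "dim_col (lawrence_lifting r A) = r * dim_col A"
  by (simp_all add: lawrence_lifting_def append_rows_def dim_diag_block_replicate)

lemma sum_blocks:
  fixes f :: "nat \<Rightarrow> 'a::comm_monoid_add"
  shows "(\<Sum>t<r * n. f t) = (\<Sum>i<r. \<Sum>j<n. f (i * n + j))"
proof -
  have "(\<Sum>t\<in>{i * n..<i * n + n}. f t) = (\<Sum>j<n. f (i * n + j))" for i
    by (subst sum.atLeastLessThan_shift_0) (simp add: lessThan_atLeast0)
  then show ?thesis by (simp add: sum.nat_group[symmetric])
qed

lemma block_index_less: "i < r \<Longrightarrow> j < n \<Longrightarrow> i * n + j < r * (n::nat)"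
proof -
  assume "i < r" "j < n"
  then have "i * n + j < Suc i * n" by simp
  also have "\<dots> \<le> r * n" using \<open>i < r\<close> by (intro mult_le_mono1) simp
  finally show ?thesis .
qed

lemma lawrence_kernel_iff:
  fixes A :: "int mat"
  assumes v: "v \<in> carrier_vec (r * dim_col A)"
  shows "v \<in> mat_kernel (lawrence_lifting r A) \<longleftrightarrow>
    (\<forall>i<r. \<forall>k<dim_row A. (\<Sum>j<dim_col A. A $$ (k, j) * v $ (i * dim_col A + j)) = 0) \<and>
    (\<forall>j<dim_col A. (\<Sum>i<r. v $ (i * dim_col A + j)) = 0)"
proof -
  let ?R = "dim_row A" and ?n = "dim_col A"
  let ?D = "diag_block_mat (replicate r A)"
  let ?E = "mat ?n (r * ?n) (\<lambda>(i, j). if j mod ?n = i then 1 else 0) :: int mat"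
  have D: "?D \<in> carrier_mat (r * ?R) (r * ?n)" by (rule carrier_matI) (rule dim_diag_block_replicate)+
  have E: "?E \<in> carrier_mat ?n (r * ?n)" by simp
  have L: "lawrence_lifting r A *\<^sub>v v = (?D *\<^sub>v v) @\<^sub>v (?E *\<^sub>v v)"
    unfolding lawrence_lifting_def by (rule mat_mult_append[OF D E v])
  have rowD: "(?D *\<^sub>v v) $ (i * ?R + k) = (\<Sum>j<?n. A $$ (k, j) * v $ (i * ?n + j))"
    if i: "i < r" and k: "k < ?R" for i k
  proof -
    have ik: "i * ?R + k < r * ?R" using block_index_less i k by blast
    have "(?D *\<^sub>v v) $ (i * ?R + k) = (\<Sum>t<r * ?n. ?D $$ (i * ?R + k, t) * v $ t)"
      using D v ik by (simp add: scalar_prod_def lessThan_atLeast0)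
    also have "\<dots> = (\<Sum>i'<r. \<Sum>j<?n. ?D $$ (i * ?R + k, i' * ?n + j) * v $ (i' * ?n + j))"
      by (rule sum_blocks)
    also have "\<dots> = (\<Sum>i'<r. if i' = i then \<Sum>j<?n. A $$ (k, j) * v $ (i * ?n + j) else 0)"
      using ik k by (intro sum.cong refl)
        (auto simp: index_diag_block_replicate block_index_less intro!: sum.neutral)
    also have "\<dots> = (\<Sum>j<?n. A $$ (k, j) * v $ (i * ?n + j))"
      using i by (subst sum.delta) auto
    finally show ?thesis .
  qed
  have rowE: "(?E *\<^sub>v v) $ j = (\<Sum>i<r. v $ (i * ?n + j))" if j: "j < ?n" for j
  proof -
    have "(?E *\<^sub>v v) $ j = (\<Sum>t<r * ?n. ?E $$ (j, t) * v $ t)"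
      using v j by (simp add: scalar_prod_def lessThan_atLeast0)
    also have "\<dots> = (\<Sum>i<r. \<Sum>j'<?n. ?E $$ (j, i * ?n + j') * v $ (i * ?n + j'))"
      by (rule sum_blocks)
    also have "\<dots> = (\<Sum>i<r. \<Sum>j'<?n. if j' = j then v $ (i * ?n + j) else 0)"
      using j by (intro sum.cong refl) (auto simp: block_index_less)
    finally show ?thesis using j by simp
  qed
  have "v \<in> mat_kernel (lawrence_lifting r A) \<longleftrightarrow>
      (\<forall>t<r * ?R + ?n. ((?D *\<^sub>v v) @\<^sub>v (?E *\<^sub>v v)) $ t = 0)"
  proof -
    have "v \<in> mat_kernel (lawrence_lifting r A) \<longleftrightarrow>
        (?D *\<^sub>v v) @\<^sub>v (?E *\<^sub>v v) = 0\<^sub>v (r * ?R + ?n)"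
      using v unfolding mat_kernel_def L[symmetric] by (simp add: dim_lawrence_lifting)
    moreover have "w = 0\<^sub>v m \<longleftrightarrow> (\<forall>t<m. w $ t = 0)" if "dim_vec w = m" for w :: "int vec" and m
      using that by (auto simp: vec_eq_iff)
    moreover have "dim_vec ((?D *\<^sub>v v) @\<^sub>v (?E *\<^sub>v v)) = r * ?R + ?n"
      by (simp add: dim_diag_block_replicate)
    ultimately show ?thesis by blast
  qed
  also have "\<dots> \<longleftrightarrow> (\<forall>t<r * ?R. (?D *\<^sub>v v) $ t = 0) \<and> (\<forall>j<?n. (?E *\<^sub>v v) $ j = 0)"
  proof (intro iffI conjI allI impI)
    assume h: "\<forall>t<r * ?R + ?n. ((?D *\<^sub>v v) @\<^sub>v (?E *\<^sub>v v)) $ t = 0"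
    show "(?D *\<^sub>v v) $ t = 0" if "t < r * ?R" for t
      using h[rule_format, of t] that by (simp add: dim_diag_block_replicate del: index_mult_mat_vec)
    show "(?E *\<^sub>v v) $ j = 0" if "j < ?n" for j
      using h[rule_format, of "r * ?R + j"] that
      by (simp add: dim_diag_block_replicate del: index_mult_mat_vec)
  next
    fix t
    assume "(\<forall>t<r * ?R. (?D *\<^sub>v v) $ t = 0) \<and> (\<forall>j<?n. (?E *\<^sub>v v) $ j = 0)" "t < r * ?R + ?n"
    then show "((?D *\<^sub>v v) @\<^sub>v (?E *\<^sub>v v)) $ t = 0"
      by (auto simp: dim_diag_block_replicate less_diff_conv2 simp del: index_mult_mat_vec)
  qed
  also have "(\<forall>t<r * ?R. (?D *\<^sub>v v) $ t = 0) \<longleftrightarrow> (\<forall>i<r. \<forall>k<?R. (?D *\<^sub>v v) $ (i * ?R + k) = 0)"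
  proof (intro iffI allI impI)
    fix t assume h: "\<forall>i<r. \<forall>k<?R. (?D *\<^sub>v v) $ (i * ?R + k) = 0" and t: "t < r * ?R"
    then have "0 < ?R" by (cases "?R = 0") simp_all
    with h[rule_format, of "t div ?R" "t mod ?R"] t show "(?D *\<^sub>v v) $ t = 0"
      by (simp add: less_mult_imp_div_less)
  qed (simp add: block_index_less)
  finally show ?thesis using rowD rowE by simp
qed

lemma dim_curve_matrix [simp]:
  "dim_row (curve_matrix a) = 1" "dim_col (curve_matrix a) = length a"
  by (simp_all add: curve_matrix_def)

lemma lawrence_curve_kernel_iff:
  assumes "v \<in> carrier_vec (r * length l)"
  shows "v \<in> mat_kernel (lawrence_lifting r (curve_matrix l)) \<longleftrightarrow>
    (\<forall>i<r. (\<Sum>j<length l. int (l ! j) * v $ (i * length l + j)) = 0) \<and>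
    (\<forall>j<length l. (\<Sum>i<r. v $ (i * length l + j)) = 0)"
  using lawrence_kernel_iff[of v r "curve_matrix l"] assms by (simp add: curve_matrix_def)

section \<open>An element of type three\<close>

text \<open>The three columns of the matrix \<open>X\<close> are placed at the positions listed in \<open>c\<close>, all other columns
are zero. For a list of distinct positions at most one summand is nonzero; the sum serves to avoid
a nested case distinction.\<close>

definition pad :: "nat \<Rightarrow> nat list \<Rightarrow> (nat \<Rightarrow> nat \<Rightarrow> nat) \<Rightarrow> int vec" where
  "pad m c X = vec (3 * m) (\<lambda>t. \<Sum>s<3. if t mod m = c ! s then int (X (t div m) s) else 0)"

lemma sum_lessThan_3: "(\<Sum>s<3::nat. f s) = f 0 + f 1 + f 2"
  for f :: "nat \<Rightarrow> 'a::comm_monoid_add"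
  by (simp add: numeral_3_eq_3 numeral_2_eq_2)

lemma all_less_3: "(\<forall>s<3::nat. P s) \<longleftrightarrow> P 0 \<and> P 1 \<and> P 2"
  by (auto simp: numeral_3_eq_3 numeral_2_eq_2 less_Suc_eq)

lemma pad_carrier [simp]: "pad m c X \<in> carrier_vec (3 * m)"
  by (simp add: pad_def)

lemma index_pad:
  assumes "r < 3" "j < m"
  shows "pad m c X $ (r * m + j) = (\<Sum>s<3. if j = c ! s then int (X r s) else 0)"
proof -
  have "pad m c X $ (r * m + j) =
      (\<Sum>s<3. if (r * m + j) mod m = c ! s then int (X ((r * m + j) div m) s) else 0)"
    unfolding pad_def using assms by (intro index_vec block_index_less)
  moreover have "(r * m + j) div m = r" "(r * m + j) mod m = j"
    using assms by (simp_all add: div_add1_eq)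
  ultimately show ?thesis by (simp only:)
qed

lemma pad_cong: "(\<And>r s. r < 3 \<Longrightarrow> s < 3 \<Longrightarrow> X r s = Y r s) \<Longrightarrow> pad m c X = pad m c Y"
  unfolding pad_def
  by (intro eq_vecI) (auto simp: less_mult_imp_div_less intro!: sum.cong)

lemma pad_nonneg: "pad m c X \<in> nonneg_vecs (3 * m)"
  by (auto simp: nonneg_vecs_def pad_def intro!: sum_nonneg)

lemma weight_pad:
  assumes "r < 3" and c: "\<forall>s<3. c ! s < length l"
  shows "(\<Sum>j<length l. int (l ! j) * pad (length l) c X $ (r * length l + j)) =
    int (\<Sum>s<3. X r s * l ! (c ! s))"
proof -
  have "(\<Sum>j<length l. int (l ! j) * pad (length l) c X $ (r * length l + j)) =
      (\<Sum>j<length l. \<Sum>s<3. if j = c ! s then int (X r s * l ! j) else 0)"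
    using assms by (intro sum.cong refl) (auto simp: index_pad sum_distrib_left intro!: sum.cong)
  also have "\<dots> = (\<Sum>s<3. \<Sum>j<length l. if j = c ! s then int (X r s * l ! j) else 0)"
    by (rule sum.swap)
  also have "\<dots> = (\<Sum>s<3. int (X r s * l ! (c ! s)))"
    using c by (intro sum.cong refl) (simp add: sum.delta)
  finally show ?thesis by simp
qed

lemma pad_diff_kernel_iff:
  assumes c: "distinct c" "length c = 3" "\<forall>s<3. c ! s < length l"
  shows "pad (length l) c X - pad (length l) c Y \<in> mat_kernel (lawrence_lifting 3 (curve_matrix l)) \<longleftrightarrow>
    (\<forall>r<3. (\<Sum>s<3. X r s * l ! (c ! s)) = (\<Sum>s<3. Y r s * l ! (c ! s))) \<and>
    (\<forall>s<3. (\<Sum>r<3. X r s) = (\<Sum>r<3. Y r s))"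
proof -
  let ?m = "length l"
  let ?x = "pad ?m c X" and ?y = "pad ?m c Y"
  have idx: "(?x - ?y) $ (r * ?m + j) = ?x $ (r * ?m + j) - ?y $ (r * ?m + j)"
    if "r < 3" "j < ?m" for r j
    using block_index_less[OF that] by (simp add: pad_def)
  have rows: "(\<Sum>j<?m. int (l ! j) * (?x - ?y) $ (r * ?m + j)) =
      int (\<Sum>s<3. X r s * l ! (c ! s)) - int (\<Sum>s<3. Y r s * l ! (c ! s))" if r: "r < 3" for r
  proof -
    have "(\<Sum>j<?m. int (l ! j) * (?x - ?y) $ (r * ?m + j)) =
        (\<Sum>j<?m. int (l ! j) * ?x $ (r * ?m + j)) - (\<Sum>j<?m. int (l ! j) * ?y $ (r * ?m + j))"
      unfolding sum_subtractf[symmetric]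
      using r by (intro sum.cong refl) (simp add: idx right_diff_distrib)
    then show ?thesis unfolding weight_pad[OF r c(3)] .
  qed
  have cols: "(\<Sum>r<3. (?x - ?y) $ (r * ?m + j)) =
      (\<Sum>s<3. if j = c ! s then int (\<Sum>r<3. X r s) - int (\<Sum>r<3. Y r s) else 0)" if j: "j < ?m" for j
  proof -
    have "(\<Sum>r<3. (?x - ?y) $ (r * ?m + j)) =
        (\<Sum>r<3. \<Sum>s<3. if j = c ! s then int (X r s) - int (Y r s) else 0)"
      using j by (intro sum.cong refl) (auto simp: idx index_pad sum_subtractf[symmetric] intro!: sum.cong)
    also have "\<dots> = (\<Sum>s<3. \<Sum>r<3. if j = c ! s then int (X r s) - int (Y r s) else 0)"
      by (rule sum.swap)
    also have "\<dots> = (\<Sum>s<3. if j = c ! s then int (\<Sum>r<3. X r s) - int (\<Sum>r<3. Y r s) else 0)"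
      by (intro sum.cong refl) (auto simp: sum_subtractf)
    finally show ?thesis .
  qed
  have "(\<forall>j<?m. (\<Sum>r<3. (?x - ?y) $ (r * ?m + j)) = 0) \<longleftrightarrow>
      (\<forall>s<3. int (\<Sum>r<3. X r s) - int (\<Sum>r<3. Y r s) = 0)"
  proof (intro iffI allI impI)
    fix s assume h: "\<forall>j<?m. (\<Sum>r<3. (?x - ?y) $ (r * ?m + j)) = 0" and s: "s < (3::nat)"
    have cs: "c ! s < ?m" using c s by blast
    have "(\<Sum>s'<3. if c ! s = c ! s' then int (\<Sum>r<3. X r s') - int (\<Sum>r<3. Y r s') else 0) =
        (\<Sum>s'<3. if s = s' then int (\<Sum>r<3. X r s') - int (\<Sum>r<3. Y r s') else 0)"
      using c s by (intro sum.cong refl) (auto simp: nth_eq_iff_index_eq)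
    also have "\<dots> = int (\<Sum>r<3. X r s) - int (\<Sum>r<3. Y r s)"
      using s by (subst sum.delta') auto
    finally show "int (\<Sum>r<3. X r s) - int (\<Sum>r<3. Y r s) = 0" using h cs cols[OF cs] by simp
  next
    fix j assume "\<forall>s<3. int (\<Sum>r<3. X r s) - int (\<Sum>r<3. Y r s) = 0" "j < ?m"
    then show "(\<Sum>r<3. (?x - ?y) $ (r * ?m + j)) = 0"
      using cols by (auto intro!: sum.neutral)
  qed
  moreover have "(\<forall>r<3. (\<Sum>j<?m. int (l ! j) * (?x - ?y) $ (r * ?m + j)) = 0) \<longleftrightarrow>
      (\<forall>r<3. (\<Sum>s<3. X r s * l ! (c ! s)) = (\<Sum>s<3. Y r s * l ! (c ! s)))"
    using rows by (simp del: of_nat_sum)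
  moreover have "?x - ?y \<in> carrier_vec (3 * ?m)" by simp
  ultimately show ?thesis by (simp add: lawrence_curve_kernel_iff del: of_nat_sum)
qed

text \<open>In a column outside \<open>c\<close> the nonnegative entries of a fibre element have the sum zero.\<close>

lemma fiber_pad:
  assumes c: "distinct c" "length c = 3" "\<forall>s<3. c ! s < length l"
    and y: "y \<in> nonneg_vecs (3 * length l)"
    and k: "pad (length l) c X - y \<in> mat_kernel (lawrence_lifting 3 (curve_matrix l))"
  shows "\<exists>Y. y = pad (length l) c Y"
proof -
  let ?m = "length l"
  let ?x = "pad ?m c X"
  have cy: "y \<in> carrier_vec (3 * ?m)" using y by (simp add: nonneg_vecs_def)
  have nn: "0 \<le> y $ (r * ?m + j)" if "r < 3" "j < ?m" for r j
    using y block_index_less[OF that] by (simp add: nonneg_vecs_def)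
  have zero: "y $ (r * ?m + j) = 0" if r: "r < 3" and j: "j < ?m" "j \<notin> set c" for r j
  proof -
    have "(\<Sum>r<3. (?x - y) $ (r * ?m + j)) = 0"
      using k lawrence_curve_kernel_iff[of "?x - y" 3 l] cy j by simp
    moreover have "(?x - y) $ (r * ?m + j) = - y $ (r * ?m + j)" if "r < 3" for r
    proof -
      have "?x $ (r * ?m + j) = 0"
        unfolding index_pad[OF that j(1)] using j(2) c(2) by (intro sum.neutral) auto
      then show ?thesis using block_index_less[OF that j(1)] cy by simp
    qed
    ultimately have "(\<Sum>r<3. y $ (r * ?m + j)) = 0" by (simp add: sum_negf)
    moreover have "(\<Sum>r<3. y $ (r * ?m + j)) = 0 \<longleftrightarrow> (\<forall>r\<in>{..<3}. y $ (r * ?m + j) = 0)"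
      using nn j by (intro sum_nonneg_eq_0_iff) auto
    ultimately show ?thesis using r by simp
  qed
  define Y where "Y r s = nat (y $ (r * ?m + c ! s))" for r s
  have "y = pad ?m c Y"
  proof (rule eq_vecI)
    fix t assume "t < dim_vec (pad ?m c Y)"
    then have t: "t < 3 * ?m" by (simp add: pad_def)
    define r j where "r = t div ?m" and "j = t mod ?m"
    have "0 < ?m" using t by (cases "?m = 0") simp_all
    then have rj: "r < 3" "j < ?m" "t = r * ?m + j"
      using t by (simp_all add: r_def j_def less_mult_imp_div_less)
    show "y $ t = pad ?m c Y $ t"
    proof (cases "j \<in> set c")
      case True
      then obtain s where s: "s < 3" "j = c ! s" using c(2) by (metis in_set_conv_nth)
      have "pad ?m c Y $ t = (\<Sum>s'<3. if s = s' then int (Y r s') else 0)"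
        unfolding rj(3) index_pad[OF rj(1,2)] using c s
        by (intro sum.cong refl) (auto simp: nth_eq_iff_index_eq)
      also have "\<dots> = int (Y r s)" using s by (subst sum.delta') auto
      finally show ?thesis using nn[OF rj(1,2)] by (simp add: Y_def rj(3) s(2))
    next
      case False
      have "pad ?m c Y $ t = 0"
        unfolding rj(3) index_pad[OF rj(1,2)] using False c(2) by (intro sum.neutral) auto
      with zero[OF rj(1,2) False] show ?thesis by (simp add: rj(3))
    qed
  qed (use cy in \<open>simp add: pad_def\<close>)
  then show ?thesis by blast
qed

lemma lawrence_type_uminus:
  assumes "v \<in> carrier_vec (r * n)"
  shows "lawrence_type r n (- v) = lawrence_type r n v"
proof -
  have "(- v) $ (i * n + j) = - v $ (i * n + j)" if "i < r" "j < n" for i j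
    using assms block_index_less[OF that] by simp
  then have "{i. i < r \<and> (\<exists>j<n. (- v) $ (i * n + j) \<noteq> 0)} = {i. i < r \<and> (\<exists>j<n. v $ (i * n + j) \<noteq> 0)}"
    by auto
  then show ?thesis by (simp add: lawrence_type_def)
qed

text \<open>The element is $\mathrm{diag}(n_1, n_2, n_3) - u$, with \<open>D\<close> and \<open>U\<close> for the two matrices. Its diagonal
entries are nonzero, so all three rows count for the type.\<close>

lemma type_three_element:
  assumes c: "distinct c" "length c = 3" "\<forall>s<3. c ! s < length l"
    and nc: "noncoincident (l ! (c ! 0)) (l ! (c ! 1)) (l ! (c ! 2)) n1 n2 n3"
  shows "\<exists>v \<in> universal_markov_basis (lawrence_lifting 3 (curve_matrix l)).
    lawrence_type 3 (length l) v = 3"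
proof -
  let ?m = "length l" and ?M = "lawrence_lifting 3 (curve_matrix l)"
  have crit: "critical n1 (l ! (c ! 0)) (l ! (c ! 1)) (l ! (c ! 2))"
    "critical n2 (l ! (c ! 1)) (l ! (c ! 0)) (l ! (c ! 2))"
    "critical n3 (l ! (c ! 2)) (l ! (c ! 0)) (l ! (c ! 1))"
    using nc by (simp_all add: noncoincident_def)
  obtain u12 u13 where eq1: "n1 * l ! (c ! 0) = u12 * l ! (c ! 1) + u13 * l ! (c ! 2)"
    using crit(1) by (auto simp: critical_def)
  obtain u21 u23 where eq2: "n2 * l ! (c ! 1) = u21 * l ! (c ! 0) + u23 * l ! (c ! 2)"
    using crit(2) by (auto simp: critical_def)
  obtain u31 u32 where eq3: "n3 * l ! (c ! 2) = u31 * l ! (c ! 0) + u32 * l ! (c ! 1)"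
    using crit(3) by (auto simp: critical_def)
  note sums = noncoincident_column_sums[OF nc eq1 eq2 eq3]
  have n: "0 < n1" "0 < n2" "0 < n3" using crit by (auto simp: critical_def)
  define D where "D r s = [[n1, 0, 0], [0, n2, 0], [0, 0, n3]] ! r ! s" for r s
  have D_entries: "D 0 0 = n1" "D 0 1 = 0" "D 0 2 = 0" "D 1 0 = 0" "D 1 1 = n2" "D 1 2 = 0"
    "D 2 0 = 0" "D 2 1 = 0" "D 2 2 = n3"
    by (simp_all add: D_def)
  define U where "U r s = [[0, u12, u13], [u21, 0, u23], [u31, u32, 0]] ! r ! s" for r s
  let ?w = "pad ?m c D" and ?u = "pad ?m c U"
  have dim: "dim_col ?M = 3 * ?m" by (simp add: dim_lawrence_lifting)
  note mk = pad_diff_kernel_iff[OF c, unfolded all_less_3 sum_lessThan_3]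
  have ker: "?w - ?u \<in> mat_kernel ?M"
    unfolding mk using eq1 eq2 eq3 sums by (simp add: D_def U_def)
  have diag: "(?w - ?u) $ (r * ?m + c ! r) = int (D r r)" if r: "r < 3" for r
  proof -
    have cr: "c ! r < ?m" using c r by blast
    have entry: "pad ?m c X $ (r * ?m + c ! r) = int (X r r)" for X
    proof -
      have "pad ?m c X $ (r * ?m + c ! r) = (\<Sum>s<3. if r = s then int (X r s) else 0)"
        unfolding index_pad[OF r cr] using c r by (intro sum.cong refl) (auto simp: nth_eq_iff_index_eq)
      then show ?thesis using r by simp
    qed
    have "U r r = 0" using r by (auto simp: U_def numeral_3_eq_3 less_Suc_eq)
    moreover have "(?w - ?u) $ (r * ?m + c ! r) = ?w $ (r * ?m + c ! r) - ?u $ (r * ?m + c ! r)"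
      using block_index_less[OF r cr] by (simp add: pad_def)
    ultimately show ?thesis by (simp add: entry)
  qed
  have "D r r \<noteq> 0" if "r < 3" for r
    using that n by (auto simp: D_def numeral_3_eq_3 less_Suc_eq)
  with diag c(3) have rows: "\<exists>j<?m. (?w - ?u) $ (r * ?m + j) \<noteq> 0" if "r < 3" for r
    using that by (metis of_nat_eq_0_iff)
  then have "{r. r < 3 \<and> (\<exists>j<?m. (?w - ?u) $ (r * ?m + j) \<noteq> 0)} = {..<3}" by auto
  then have type: "lawrence_type 3 ?m (?w - ?u) = 3" by (simp add: lawrence_type_def)
  then have type': "lawrence_type 3 ?m (- (?w - ?u)) = 3" by (simp add: lawrence_type_uminus)
  have ne: "?w \<noteq> ?u"
  proof
    assume "?w = ?u"
    then have "?w - ?u = 0\<^sub>v (3 * ?m)" using pad_carrier by (metis minus_cancel_vec)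
    with rows[of 0] show False by auto
  qed
  have fib: "y = ?w \<or> y = ?u" if y: "y \<in> nonneg_vecs (3 * ?m)" and k: "?w - y \<in> mat_kernel ?M" for y
  proof -
    obtain Y where Y: "y = pad ?m c Y" using fiber_pad[OF c y k] by blast
    have "(n1 * l ! (c ! 0) = Y 0 0 * l ! (c ! 0) + Y 0 1 * l ! (c ! 1) + Y 0 2 * l ! (c ! 2) \<and>
        n2 * l ! (c ! 1) = Y 1 0 * l ! (c ! 0) + Y 1 1 * l ! (c ! 1) + Y 1 2 * l ! (c ! 2) \<and>
        n3 * l ! (c ! 2) = Y 2 0 * l ! (c ! 0) + Y 2 1 * l ! (c ! 1) + Y 2 2 * l ! (c ! 2)) \<and>
        n1 = Y 0 0 + Y 1 0 + Y 2 0 \<and> n2 = Y 0 1 + Y 1 1 + Y 2 1 \<and> n3 = Y 0 2 + Y 1 2 + Y 2 2"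
      using k unfolding Y mk D_entries mult_0 add_0_left add_0_right .
    then have eqs:
      "n1 * l ! (c ! 0) = Y 0 0 * l ! (c ! 0) + Y 0 1 * l ! (c ! 1) + Y 0 2 * l ! (c ! 2)"
      "n2 * l ! (c ! 1) = Y 1 0 * l ! (c ! 0) + Y 1 1 * l ! (c ! 1) + Y 1 2 * l ! (c ! 2)"
      "n3 * l ! (c ! 2) = Y 2 0 * l ! (c ! 0) + Y 2 1 * l ! (c ! 1) + Y 2 2 * l ! (c ! 2)"
      "n1 = Y 0 0 + Y 1 0 + Y 2 0" "n2 = Y 0 1 + Y 1 1 + Y 2 1" "n3 = Y 0 2 + Y 1 2 + Y 2 2"
      by blast+
    have split: "pad ?m c Y = pad ?m c Z" if "\<forall>r<3. \<forall>s<3. Y r s = Z r s" for Z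
      using that by (intro pad_cong) auto
    from noncoincident_fiber[OF nc eq1 eq2 eq3 eqs[symmetric]]
    have "(\<forall>r<3. \<forall>s<3. Y r s = D r s) \<or> (\<forall>r<3. \<forall>s<3. Y r s = U r s)"
      unfolding all_less_3 by (elim disjE) (simp_all add: D_def U_def)
    then show ?thesis unfolding Y using split by blast
  qed
  obtain B where B: "is_minimal_markov_basis ?M B" using minimal_markov_basis_exists by blast
  then have "is_markov_basis ?M B" by (simp add: is_minimal_markov_basis_def)
  then have "?w - ?u \<in> B \<or> - (?w - ?u) \<in> B"
    using indispensable[of ?w ?M ?u B] ker ne fib pad_nonneg unfolding dim by blast
  with B type type' show ?thesis unfolding universal_markov_basis_def by blast
qed

section \<open>Markov complexity two\<close>

lemma lawrence_type_le_markov_complexity: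
  assumes "2 \<le> r" "v \<in> universal_markov_basis (lawrence_lifting r A)"
  shows "enat (lawrence_type r (dim_col A) v) \<le> markov_complexity A"
  unfolding markov_complexity_def using assms by (auto intro!: SUP_upper2)

theorem corollary2p5:
  fixes l :: "nat list" and i j k :: nat
  assumes "monomial_curve l"
    and "markov_complexity (curve_matrix l) = 2"
    and "i < length l" and "j < length l" and "k < length l"
    and "i \<noteq> j" and "i \<noteq> k" and "j \<noteq> k"
  shows "complete_intersection TYPE('k::field) [l ! i, l ! j, l ! k]"
proof -
  let ?a = "l ! i" and ?b = "l ! j" and ?c = "l ! k"
  have pos: "0 < ?a" "0 < ?b" "0 < ?c" using assms(1,3-5) by (auto simp: monomial_curve_def)
  obtain n1 where n1: "critical n1 ?a ?b ?c" using critical_exists pos by blast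
  obtain n2 where n2: "critical n2 ?b ?a ?c" using critical_exists pos by blast
  obtain n3 where n3: "critical n3 ?c ?a ?b" using critical_exists pos by blast
  have "\<not> noncoincident ?a ?b ?c n1 n2 n3"
  proof
    assume nc: "noncoincident ?a ?b ?c n1 n2 n3"
    let ?x = "[i, j, k]"
    have c: "distinct ?x" "length ?x = 3" "\<forall>s<3. ?x ! s < length l"
      using assms(3-8) by (simp_all add: all_less_3)
    obtain v where "v \<in> universal_markov_basis (lawrence_lifting 3 (curve_matrix l))"
      "lawrence_type 3 (length l) v = 3"
      using type_three_element[OF c, of n1 n2 n3] nc by auto
    then have "enat 3 \<le> 2"
      using lawrence_type_le_markov_complexity[of 3 v "curve_matrix l"] assms(2) by simp
    then show False by (simp add: numeral_eq_enat)
  qed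
  then consider "n1 * ?a = n2 * ?b" | "n1 * ?a = n3 * ?c" | "n2 * ?b = n3 * ?c"
    using pos n1 n2 n3 unfolding noncoincident_def by blast
  then show ?thesis
  proof cases
    case 1
    then show ?thesis using pos n1 n2 n3
      by (intro complete_intersection_if_coincident[of _ 0 1 2 n1 n2 n3]) auto
  next
    case 2
    then show ?thesis using pos n1 n2 n3 critical_swap
      by (intro complete_intersection_if_coincident[of _ 0 2 1 n1 n3 n2]) auto
  next
    case 3
    then show ?thesis using pos n1 n2 n3 critical_swap
      by (intro complete_intersection_if_coincident[of _ 1 2 0 n2 n3 n1]) auto
  qed
qed

end
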